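(* Let $n\in\mathbb N=\{0,1,2,\dots\}$. The reproducing kernel of $H_n^2(\mathbb C^+)$ is given by $$K_n(z,w)=\frac1{2\pi}\int_0^\infty\frac{1-x^2}{1-x^{2n+2}}\,e^{ix(w-\overline z)}\,dx,\qquad z,w\in\mathbb C^+.$$ That is, for each $z\in\mathbb C^+$ the function $K_{n,z}(w)=K_n(z,w)$ belongs to $H_n^2(\mathbb C^+)$ and $F(z)=\langle F,K_{n,z}\rangle_{H_n^2}$ for all $F\in H_n^2(\mathbb C^+)$.
   Context: $\mathbb C^+=\{z\in\mathbb C:\operatorname{Im} z>0\}$. $H^2(\mathbb C^+)$ is the Hardy space of holomorphic $F$ on $\mathbb C^+$ with $\|F\|_{H^2}=\sup_{y>0}\left(\int_{\mathbb R}|F(x+iy)|^2\,dx\right)^{1/2}<\infty$; it is a Hilbert space with the $L^2(\mathbb R)$ inner product of nontangential boundary values. $H_n^2(\mathbb C^+)$ is the Hilbert space of holomorphic $F$ on $\mathbb C^+$ with $F^{(k)}\in H^2(\mathbb C^+)$ for $k=0,1,\dots,n$, with inner product $\langle F,G\rangle_{H_n^2}=\sum_{k=0}^n\langle F^{(k)},G^{(k)}\rangle_{H^2}$ (linear in the first argument). The quotient $\frac{1-x^2}{1-x^{2n+2}}$ is extended continuously at $x=1$, i.e. it equals $\frac1{1+x^2+\cdots+x^{2n}}$. *)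

theory Defs
  imports "HOL-Analysis.Analysis"
begin

definition upper_half_plane :: "complex set" where
  "upper_half_plane = {z. 0 < Im z}"

text \<open>
  The square of the Hardy norm, as an extended nonnegative real. Elements of the Hardy space are
  represented by functions on the whole complex plane; their values outside the upper half-plane
  are never used.
\<close>

definition hardy_norm_sq :: "(complex \<Rightarrow> complex) \<Rightarrow> ennreal" where
  "hardy_norm_sq F =
     (SUP y\<in>{0::real<..}. \<integral>\<^sup>+ x. ennreal ((cmod (F (Complex x y)))\<^sup>2) \<partial>lborel)"

definition hardy_space :: "(complex \<Rightarrow> complex) set" where
  "hardy_space = {F. F holomorphic_on upper_half_plane \<and> hardy_norm_sq F < \<infinity>}"

definition stolz_angle :: "real \<Rightarrow> real \<Rightarrow> complex set" where
  "stolz_angle a x = {z. 0 < Im z \<and> \<bar>Re z - x\<bar> < a * Im z}"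

definition has_nontangential_limit :: "(complex \<Rightarrow> complex) \<Rightarrow> real \<Rightarrow> complex \<Rightarrow> bool" where
  "has_nontangential_limit F x l \<longleftrightarrow>
     (\<forall>a>0. (F \<longlongrightarrow> l) (at (complex_of_real x) within stolz_angle a x))"

text \<open>
  The value is arbitrary where no nontangential limit exists. For functions in the Hardy space this
  is a null set, so the Lebesgue integrals below do not depend on it; they are taken with
  respect to the complete measure \<open>lebesgue\<close>, so that changes on null sets
  do not affect measurability either.
\<close>

definition boundary_value :: "(complex \<Rightarrow> complex) \<Rightarrow> real \<Rightarrow> complex" where
  "boundary_value F x = (THE l. has_nontangential_limit F x l)"

definition hardy_inner :: "(complex \<Rightarrow> complex) \<Rightarrow> (complex \<Rightarrow> complex) \<Rightarrow> complex" where
  "hardy_inner F G = (LINT x|lebesgue. boundary_value F x * cnj (boundary_value G x))"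

definition hardy_sobolev_space :: "nat \<Rightarrow> (complex \<Rightarrow> complex) set" where
  "hardy_sobolev_space n =
     {F. F holomorphic_on upper_half_plane \<and> (\<forall>k\<le>n. (deriv ^^ k) F \<in> hardy_space)}"

definition hardy_sobolev_inner ::
    "nat \<Rightarrow> (complex \<Rightarrow> complex) \<Rightarrow> (complex \<Rightarrow> complex) \<Rightarrow> complex" where
  "hardy_sobolev_inner n F G = (\<Sum>k\<le>n. hardy_inner ((deriv ^^ k) F) ((deriv ^^ k) G))"

text \<open>The argument \<open>K z\<close> is the kernel function \<open>w \<mapsto> K(z,w)\<close> at the point \<open>z\<close>.\<close>

definition is_reproducing_kernel ::
    "'a set \<Rightarrow> ('a \<Rightarrow> 'b) set \<Rightarrow> (('a \<Rightarrow> 'b) \<Rightarrow> ('a \<Rightarrow> 'b) \<Rightarrow> 'b) \<Rightarrow> ('a \<Rightarrow> 'a \<Rightarrow> 'b) \<Rightarrow> bool" where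
  "is_reproducing_kernel D H ip K \<longleftrightarrow> (\<forall>z\<in>D. K z \<in> H \<and> (\<forall>F\<in>H. F z = ip F (K z)))"

text \<open>The quotient is extended continuously at \<open>x = 1\<close>.\<close>

definition kernel_weight :: "nat \<Rightarrow> real \<Rightarrow> real" where
  "kernel_weight n x =
     (if x = 1 then 1 / real (n + 1) else (1 - x ^ 2) / (1 - x ^ (2 * n + 2)))"

lemma kernel_weight_eq:
  assumes "0 \<le> x"
  shows "kernel_weight n x = 1 / (\<Sum>k\<le>n. x ^ (2 * k))"
proof (cases "x = 1")
  case True
  then show ?thesis by (simp add: kernel_weight_def)
next
  case False
  then have "x\<^sup>2 \<noteq> 1"
    using assms by (simp add: power2_eq_1_iff)
  moreover have "(1 - x\<^sup>2) * (\<Sum>k\<le>n. (x\<^sup>2) ^ k) = 1 - (x\<^sup>2) ^ Suc n"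
    by (rule sum_gp_basic)
  then have "1 - x ^ (2 * n + 2) = (1 - x\<^sup>2) * (\<Sum>k\<le>n. x ^ (2 * k))"
    by (simp add: power_mult [symmetric] power_add [symmetric] mult.commute add.commute
        del: power_Suc)
  ultimately show ?thesis
    using False by (simp add: kernel_weight_def)
qed

definition hardy_sobolev_kernel :: "nat \<Rightarrow> complex \<Rightarrow> complex \<Rightarrow> complex" where
  "hardy_sobolev_kernel n z w =
     1 / (2 * of_real pi) *
     (LINT x:{0..}|lborel.
        of_real (kernel_weight n x) * exp (\<i> * of_real x * (w - cnj z)))"

end

theory Submission
  imports
    Defs
    "HOL-Complex_Analysis.Cauchy_Integral_Formula"
    "HOL-Probability.Sinc_Integral"
    "HOL-Real_Asymp.Real_Asymp"
begin

text \<open>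
  Formally the theorem is Parseval's identity: on the Fourier side the norm of \<open>H\<^sup>2\<^sub>n\<close> has the weight
  \<open>1 + x\<^sup>2 + \<dots> + x\<^bsup>2n\<^esup>\<close>, and the kernel carries the reciprocal of that weight. The proof below never
  transforms \<open>F\<close>. Let \<open>K\<close> be the kernel at the point \<open>z\<close>, and pair the values of \<open>F\<close> on a line
  \<open>Im w = e > 0\<close> with those of \<open>K\<close> on the real line. Integration by parts moves all derivatives from \<open>F\<close> onto the kernel,
  \<open>\<langle>F\<^sup>(\<^sup>k\<^sup>), K\<^sup>(\<^sup>k\<^sup>)\<rangle> = (-1)\<^sup>k \<langle>F, K\<^bsup>(2k)\<^esup>\<rangle>\<close>, and in the sum \<open>\<Sum>k\<le>n. (-1)\<^sup>k K\<^bsup>(2k)\<^esup>\<close> the weight cancels: what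
  remains is \<open>(1/2\<pi>) \<integral>\<^sub>0\<^sup>\<infinity> exp (i x (w - cnj z)) dx = i / (2\<pi> (w - cnj z))\<close>, the Szego kernel.
  Pairing with it is Cauchy's integral formula, so the sum of the pairings is \<open>F (z + i e)\<close>
  (\<open>line_sobolev_inner_product_kernel\<close>). The theorem is the limit \<open>e \<rightarrow> 0\<close>.

  The limit is where the work lies, because the inner product is defined by nontangential boundary
  values, and about the top derivative of \<open>F\<close> nothing is known beyond membership in \<open>H\<^sup>2\<close>. Two facts about \<open>F \<in> H\<^sup>2\<close> are
  needed: nontangential limits exist almost everywhere (\<open>AE_nontangential_limit\<close>), and the
  restrictions of \<open>F\<close> to horizontal lines converge to them in \<open>L\<^sup>2\<close>
  (\<open>boundary_distance_sq_le\<close>), hence inner products converge (\<open>boundary_inner_product_limit\<close>).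

  Both come from one identity. Write \<open>N y\<close> for the squared \<open>L\<^sup>2\<close> norm of \<open>F\<close> on the line of height
  \<open>y\<close>. The function \<open>F \<zeta> * cnj (F (cnj \<zeta> + i s))\<close> is holomorphic in the strip \<open>0 < Im \<zeta> < s\<close>, so its
  integrals over horizontal lines agree, and the inner product of \<open>F\<close> on the lines \<open>y1\<close> and \<open>y2\<close> is
  \<open>N ((y1 + y2) / 2)\<close>. Consequently the squared distance of the two restrictions is
  \<open>N y1 + N y2 - 2 N ((y1 + y2) / 2)\<close> (\<open>line_distance_sq_eq\<close>). Hence \<open>N\<close> is midpoint convex and bounded,
  so it decreases and tends to \<open>\<parallel>F\<parallel>\<^sup>2\<close> as \<open>y \<rightarrow> 0\<close>, and the restrictions are Cauchy in \<open>L\<^sup>2\<close>; moreover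
  \<open>F - F (\<cdot> + i e)\<close> has small Hardy norm (\<open>hardy_vertical_difference\<close>).

  The almost everywhere convergence is then the usual maximal function argument: the Poisson formula
  and Vitali's covering lemma give a weak-type bound for the nontangential maximal function
  (\<open>nontangential_weak_type\<close>). It is applied to the small functions \<open>F - F (\<cdot> + i e)\<close>, whose second term
  is continuous up to the boundary, so off a null set \<open>F\<close> has no oscillation in Stolz angles.
\<close>

section \<open>Integrals along horizontal lines\<close>

text \<open>
  A nonzero limit would keep \<open>g\<close> away from zero on a half-line, which has infinite measure.
\<close>

lemma integrable_tendsto_at_top_zero:
  fixes g :: "real \<Rightarrow> complex"
  assumes g: "integrable lborel g" and lim: "(g \<longlongrightarrow> L) at_top"
  shows "L = 0"
proof (rule ccontr)
  assume L: "L \<noteq> 0"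
  have "eventually (\<lambda>x. norm (g x) > norm L / 2) at_top"
    using tendsto_norm[OF lim] by (rule order_tendstoD) (use L in auto)
  then obtain N where N: "\<And>x. x \<ge> N \<Longrightarrow> norm (g x) > norm L / 2"
    by (auto simp: eventually_at_top_linorder)
  have "(\<integral>\<^sup>+x. ennreal (norm L / 2) * indicator {N..} x \<partial>lborel) \<le> (\<integral>\<^sup>+x. ennreal (norm (g x)) \<partial>lborel)"
    by (intro nn_integral_mono) (auto split: split_indicator intro!: ennreal_leI dest: N)
  moreover have "(\<integral>\<^sup>+x. ennreal (norm L / 2) * indicator {N..} x \<partial>lborel) = \<infinity>"
  proof -
    have "emeasure lborel {N..} = \<infinity>"
    proof (rule ccontr)
      assume "emeasure lborel {N..} \<noteq> \<infinity>"
      moreover have "ennreal (real n) \<le> emeasure lborel {N..}" for n :: nat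
        using emeasure_mono[of "{N..N + real n}" "{N..}" lborel] by auto
      ultimately show False
        by (metis ennreal_Ex_less_of_nat ennreal_of_nat_eq_real_of_nat infinity_ennreal_def
            leD top.not_eq_extremum)
    qed
    then show ?thesis using L by (simp add: nn_integral_cmult_indicator ennreal_mult_top)
  qed
  ultimately show False
    using g by (auto simp: integrable_iff_bounded)
qed

text \<open>
  The boundary terms \<open>f R - f (- R)\<close> converge to the integral and are themselves integrable in \<open>R\<close>,
  so their limit is zero; no decay of \<open>f\<close> at infinity has to be known in advance.
\<close>

lemma integral_derivative_eq_0:
  fixes f f' :: "real \<Rightarrow> complex"
  assumes deriv: "\<And>x. (f has_vector_derivative f' x) (at x)"
    and cont: "continuous_on UNIV f'"
    and f: "integrable lborel f" and f': "integrable lborel f'"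
  shows "(LINT x|lborel. f' x) = 0"
proof (rule integrable_tendsto_at_top_zero)
  show "integrable lborel (\<lambda>x. f x - f (- x))"
    using lborel_integrable_real_affine[OF f, of "-1" 0] f by auto
  have "((\<lambda>R. LINT x|lborel. indicator {-R..R} x *\<^sub>R f' x) \<longlongrightarrow> (LINT x|lborel. f' x)) at_top"
  proof (rule integral_dominated_convergence_at_top[where w = "\<lambda>x. norm (f' x)"])
    show "AE x in lborel. ((\<lambda>R. indicator {-R..R} x *\<^sub>R f' x) \<longlongrightarrow> f' x) at_top"
    proof (rule AE_I2, rule tendsto_eventually)
      fix x :: real
      show "eventually (\<lambda>R. indicator {-R..R} x *\<^sub>R f' x = f' x) at_top"
        using eventually_ge_at_top[of "\<bar>x\<bar>"] by eventually_elim (auto simp: indicator_def abs_le_iff)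
    qed
    show "\<forall>\<^sub>F i in at_top. AE x in lborel. norm (indicator {-i..i} x *\<^sub>R f' x) \<le> norm (f' x)"
      by (intro always_eventually allI AE_I2) (auto split: split_indicator)
  qed (use f' in auto)
  moreover have "eventually (\<lambda>R. (LINT x|lborel. indicator {-R..R} x *\<^sub>R f' x) = f R - f (- R)) at_top"
    using eventually_ge_at_top[of 0]
  proof eventually_elim
    case (elim R)
    show ?case
      by (rule integral_FTC_Icc)
        (use elim cont in \<open>auto intro: continuous_on_subset has_vector_derivative_at_within deriv\<close>)
  qed
  ultimately show "((\<lambda>x. f x - f (- x)) \<longlongrightarrow> (LINT x|lborel. f' x)) at_top"
    by (rule Lim_transform_eventually)
qed

lemma has_vector_derivative_Complex_Re:
  assumes "(g has_field_derivative g') (at (Complex x y))"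
  shows "((\<lambda>t. g (Complex t y)) has_vector_derivative g') (at x)"
proof -
  have "((\<lambda>t. Complex t y) has_vector_derivative 1) (at x)"
    unfolding Complex_eq by (auto intro!: derivative_eq_intros)
  from field_vector_diff_chain_at[OF this] assms show ?thesis by (simp add: o_def)
qed

lemma has_vector_derivative_Complex_Im:
  assumes "(g has_field_derivative g') (at (Complex x y))"
  shows "((\<lambda>t. g (Complex x t)) has_vector_derivative \<i> * g') (at y)"
proof -
  have "((\<lambda>t. Complex x t) has_vector_derivative \<i>) (at y)"
    unfolding Complex_eq
    by (rule derivative_eq_intros | simp)+
  from field_vector_diff_chain_at[OF this] assms show ?thesis by (simp add: o_def)
qed

lemma continuous_on_Complex [continuous_intros]:
  assumes "continuous_on S f" "continuous_on S g"
  shows "continuous_on S (\<lambda>x. Complex (f x) (g x))"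
  unfolding Complex_eq using assms by (intro continuous_intros)

lemma continuous_on_line:
  assumes "continuous_on S H" "\<And>x. Complex x y \<in> S"
  shows "continuous_on UNIV (\<lambda>x. H (Complex x y))"
  by (rule continuous_on_compose2[OF assms(1)]) (use assms in \<open>auto intro!: continuous_intros\<close>)

lemma measurable_line:
  assumes "continuous_on S H" "\<And>x. Complex x y \<in> S"
  shows "(\<lambda>x. H (Complex x y)) \<in> borel_measurable borel"
  using continuous_on_line[OF assms] by (rule borel_measurable_continuous_onI)

lemma integrable_nn_bound:
  fixes f :: "real \<Rightarrow> complex"
  assumes "f \<in> borel_measurable borel" "(\<integral>\<^sup>+x. ennreal (norm (f x)) \<partial>lborel) \<le> ennreal C"
  shows "integrable lborel f"
  using assms le_less_trans[OF assms(2)] by (simp add: integrable_iff_bounded)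

text \<open>
  Let \<open>P\<close> be a primitive of \<open>H\<close> and \<open>J x\<close> its increment along the vertical segment above \<open>x\<close>. Then \<open>J\<close> is
  dominated by the integral of \<open>|H|\<close> over that segment, hence integrable by Tonelli, while \<open>J'\<close> is the
  difference of \<open>H\<close> on the two lines. So the integral of \<open>J'\<close> vanishes. This replaces the contour
  integral over a long rectangle.
\<close>

lemma line_integral_shift:
  fixes H :: "complex \<Rightarrow> complex"
  assumes S: "open S" "convex S" and H: "H holomorphic_on S"
    and strip: "{z. y1 \<le> Im z \<and> Im z \<le> y2} \<subseteq> S" and y: "y1 \<le> y2"
    and bound: "\<And>y. y1 \<le> y \<Longrightarrow> y \<le> y2 \<Longrightarrow> (\<integral>\<^sup>+x. ennreal (norm (H (Complex x y))) \<partial>lborel) \<le> ennreal C"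
  shows "(LINT x|lborel. H (Complex x y1)) = (LINT x|lborel. H (Complex x y2))"
proof -
  have inS: "Complex x y \<in> S" if "y1 \<le> y" "y \<le> y2" for x y
    using strip that by auto
  have contH: "continuous_on S H" using H by (rule holomorphic_on_imp_continuous_on)
  obtain P where "\<And>z. z \<in> S \<Longrightarrow> (P has_field_derivative H z) (at z within S)"
    using holomorphic_convex_primitive'[OF S(2,1) H] by blast
  then have P: "(P has_field_derivative H z) (at z)" if "z \<in> S" for z
    using \<open>\<And>z. z \<in> S \<Longrightarrow> (P has_field_derivative H z) (at z within S)\<close>[OF that]
    by (simp add: at_within_open[OF that S(1)])
  define J where "J = (\<lambda>x. P (Complex x y2) - P (Complex x y1))"
  have int: "integrable lborel (\<lambda>x. H (Complex x y))" if "y1 \<le> y" "y \<le> y2" for y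
    by (rule integrable_nn_bound[OF measurable_line[OF contH]]) (use that inS bound in auto)
  have J': "(J has_vector_derivative (H (Complex x y2) - H (Complex x y1))) (at x)" for x
    unfolding J_def
    by (rule has_vector_derivative_diff; rule has_vector_derivative_Complex_Re, rule P, rule inS)
      (use y in auto)
  have J_bound: "ennreal (norm (J x)) \<le> (\<integral>\<^sup>+t. ennreal (indicator {y1..y2} t * norm (H (Complex x t))) \<partial>lborel)" for x
  proof -
    have cont: "continuous_on {y1..y2} (\<lambda>t. \<i> * H (Complex x t))"
      by (rule continuous_on_mult_left, rule continuous_on_compose2[OF contH])
        (auto intro!: continuous_intros inS)
    have D: "((\<lambda>t. P (Complex x t)) has_vector_derivative \<i> * H (Complex x t)) (at t within {y1..y2})"
      if "y1 \<le> t" "t \<le> y2" for t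
      by (rule has_vector_derivative_at_within, rule has_vector_derivative_Complex_Im, rule P, rule inS)
        (use that in auto)
    note FTC = has_bochner_integral_FTC_Icc[OF y D cont]
    have "ennreal (norm (J x)) = ennreal (norm (LINT t|lborel. indicator {y1..y2} t *\<^sub>R (\<i> * H (Complex x t))))"
      using FTC by (simp add: has_bochner_integral_iff J_def)
    also have "\<dots> \<le> (\<integral>\<^sup>+t. ennreal (norm (indicator {y1..y2} t *\<^sub>R (\<i> * H (Complex x t)))) \<partial>lborel)"
      using FTC by (intro integral_norm_bound_ennreal) (simp add: has_bochner_integral_iff)
    finally show ?thesis by (simp add: norm_mult)
  qed
  have "continuous_on (UNIV \<times> {y1..y2}) (\<lambda>(x, t). norm (H (Complex x t)))"
    unfolding case_prod_beta
    by (rule continuous_on_norm, rule continuous_on_compose2[OF contH])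
      (auto intro!: continuous_intros inS)
  then have "(\<lambda>p. indicator (UNIV \<times> {y1..y2}) p *\<^sub>R (case p of (x::real, t) \<Rightarrow> norm (H (Complex x t)))) \<in> borel_measurable borel"
    by (rule borel_measurable_continuous_on_indicator[rotated]) (auto intro!: borel_closed closed_Times)
  moreover have "(\<lambda>p. indicator (UNIV \<times> {y1..y2}) p *\<^sub>R (case p of (x::real, t) \<Rightarrow> norm (H (Complex x t)))) =
      (\<lambda>(x, t). indicator {y1..y2} t * norm (H (Complex x t)))"
    by (auto simp: fun_eq_iff split: split_indicator)
  ultimately have meas: "(\<lambda>(x, t). ennreal (indicator {y1..y2} t * norm (H (Complex x t)))) \<in> borel_measurable (lborel \<Otimes>\<^sub>M lborel)"
    by (simp add: lborel_prod case_prod_unfold)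
  have J_cont: "continuous_on UNIV J"
    by (rule continuous_on_vector_derivative[OF has_vector_derivative_at_within[OF J']])
  have "(\<integral>\<^sup>+x. ennreal (norm (J x)) \<partial>lborel) \<le>
      (\<integral>\<^sup>+x. (\<integral>\<^sup>+t. ennreal (indicator {y1..y2} t * norm (H (Complex x t))) \<partial>lborel) \<partial>lborel)"
    by (intro nn_integral_mono J_bound)
  also have "\<dots> = (\<integral>\<^sup>+t. (\<integral>\<^sup>+x. ennreal (indicator {y1..y2} t * norm (H (Complex x t))) \<partial>lborel) \<partial>lborel)"
    using lborel_pair.Fubini'[OF meas] by simp
  also have "\<dots> \<le> (\<integral>\<^sup>+t. ennreal C * indicator {y1..y2} t \<partial>lborel)"
    by (intro nn_integral_mono) (auto split: split_indicator intro: bound)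
  also have "\<dots> = ennreal C * ennreal (y2 - y1)"
    using y by (simp add: nn_integral_cmult_indicator)
  also have "\<dots> < \<infinity>" by (simp add: ennreal_mult_less_top)
  finally have intJ: "integrable lborel J"
    using borel_measurable_continuous_onI[OF J_cont] by (simp add: integrable_iff_bounded)
  have "(LINT x|lborel. H (Complex x y2) - H (Complex x y1)) = 0"
    by (rule integral_derivative_eq_0[OF J' _ intJ])
      (use int y inS in \<open>auto intro!: continuous_intros continuous_on_line[OF contH]\<close>)
  then show ?thesis using int y by (simp add: Bochner_Integration.integral_diff)
qed

lemma poisson_kernel_has_integral:
  fixes a y :: real assumes y: "0 < y"
  shows "has_bochner_integral lborel (\<lambda>t. 1 / ((t - a)\<^sup>2 + y\<^sup>2)) (pi / y)"
proof -
  have "has_bochner_integral lborel (\<lambda>x::real. 1 / (1 + x\<^sup>2)) pi"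
    using integrable_inverse_1_plus_square LBINT_inverse_1_plus_square
    by (simp add: has_bochner_integral_iff set_integrable_def interval_lebesgue_integral_def
        set_lebesgue_integral_def inverse_eq_divide del: divide_const_simps)
  then have "has_bochner_integral lborel (\<lambda>t. 1 / (1 + (- a / y + (1 / y) * t)\<^sup>2)) (pi /\<^sub>R \<bar>1 / y\<bar>)"
    using lborel_has_bochner_integral_real_affine_iff[of "1 / y" "\<lambda>x. 1 / (1 + x\<^sup>2)" pi "- a / y"] y
    by (metis divide_eq_0_iff less_irrefl zero_neq_one)
  then have "has_bochner_integral lborel (\<lambda>t. (1 / y\<^sup>2) * (1 / (1 + (- a / y + (1 / y) * t)\<^sup>2)))
     ((1 / y\<^sup>2) * (pi /\<^sub>R \<bar>1 / y\<bar>))"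
    by (rule has_bochner_integral_mult_right)
  moreover have "(1 / y\<^sup>2) * (1 / (1 + (- a / y + (1 / y) * t)\<^sup>2)) = 1 / ((t - a)\<^sup>2 + y\<^sup>2)" for t
  proof -
    have "y\<^sup>2 * (1 + (- a / y + (1 / y) * t)\<^sup>2) = (t - a)\<^sup>2 + y\<^sup>2"
      using y by (simp add: field_simps power2_eq_square)
    from arg_cong[OF this, of "\<lambda>u. 1 / u"] show ?thesis by simp
  qed
  moreover have "(1 / y\<^sup>2) * (pi /\<^sub>R \<bar>1 / y\<bar>) = pi / y"
    using y by (simp add: field_simps power2_eq_square)
  ultimately show ?thesis by (simp only:)
qed

lemma poisson_kernel_nn_integral:
  fixes a y :: real assumes y: "0 < y"
  shows "(\<integral>\<^sup>+t. ennreal (1 / ((t - a)\<^sup>2 + y\<^sup>2)) \<partial>lborel) = ennreal (pi / y)"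
  using poisson_kernel_has_integral[OF y, of a]
  by (subst nn_integral_eq_integral) (auto simp: has_bochner_integral_iff)

section \<open>A weak-type maximal inequality\<close>

text \<open>
  The Hardy--Littlewood weak-type inequality, with a finite measure in place of a function: the
  balls on which \<open>\<nu>\<close> exceeds \<open>A r\<close> have bounded radii, so Vitali's lemma selects disjoint ones whose
  fivefold enlargements still cover \<open>E\<close>. The constant is \<open>10 = 2 * 5\<close>, since a ball of radius \<open>5 r\<close> has
  length \<open>10 r\<close>.
\<close>

lemma vitali_weak_type:
  fixes \<nu> :: "real measure"
  assumes sets: "sets \<nu> = sets borel" and fin: "emeasure \<nu> UNIV < \<infinity>"
    and A: "0 < A"
    and large: "\<And>x. x \<in> E \<Longrightarrow> \<exists>r>0. ennreal (A * r) < emeasure \<nu> (cball x r)"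
  shows "emeasure lborel E \<le> ennreal (10 / A) * emeasure \<nu> UNIV"
proof -
  have [measurable_cong]: "sets \<nu> = sets borel" by (rule sets)
  obtain r where r: "\<And>x. x \<in> E \<Longrightarrow> 0 < r x" "\<And>x. x \<in> E \<Longrightarrow> ennreal (A * r x) < emeasure \<nu> (cball x (r x))"
    using large by metis
  define M where "M = enn2real (emeasure \<nu> UNIV)"
  have M: "emeasure \<nu> UNIV = ennreal M" using fin by (simp add: M_def)
  have radii: "0 < r x \<and> r x \<le> M / A" if "x \<in> E" for x
  proof -
    have "ennreal (A * r x) < ennreal M"
      using r(2)[OF that] emeasure_mono[of "cball x (r x)" UNIV \<nu>] unfolding M
      by (auto simp: sets intro: less_le_trans)
    then show ?thesis using A r(1)[OF that] by (auto simp: ennreal_less_iff field_simps)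
  qed
  obtain C where C: "countable C" "C \<subseteq> E"
     "pairwise (\<lambda>i j. disjnt (cball i (r i)) (cball j (r j))) C"
     and cover: "\<And>i. i \<in> E \<Longrightarrow> \<exists>j. j \<in> C \<and> \<not> disjnt (cball i (r i)) (cball j (r j)) \<and>
                        cball i (r i) \<subseteq> ball j (5 * r j)"
    by (rule Vitali_covering_lemma_cballs_balls[of E r "M / A" "\<lambda>x. x", OF radii])
      (assumption, rule that, assumption+)
  define k where "k = to_nat_on C"
  define c where "c = from_nat_into C"
  define X where "X = (\<lambda>i. if i \<in> k ` C then ball (c i) (5 * r (c i)) else {})"
  define Y where "Y = (\<lambda>i. if i \<in> k ` C then cball (c i) (r (c i)) else {})"
  have ck: "c (k j) = j" if "j \<in> C" for j
    using that C(1) by (simp add: k_def c_def)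
  have cC: "c i \<in> E" "c i \<in> C" if "i \<in> k ` C" for i
    using that ck C(2) by auto
  have "E \<subseteq> (\<Union>i. X i)"
  proof
    fix x assume x: "x \<in> E"
    then obtain j where "j \<in> C" "cball x (r x) \<subseteq> ball j (5 * r j)" using cover by blast
    moreover have "x \<in> cball x (r x)" using r(1)[OF x] by simp
    ultimately have "x \<in> ball j (5 * r j)" by blast
    then have "x \<in> X (k j)" using \<open>j \<in> C\<close> by (simp add: X_def ck)
    then show "x \<in> (\<Union>i. X i)" by blast
  qed
  then have "emeasure lborel E \<le> emeasure lborel (\<Union>i. X i)"
    by (intro emeasure_mono sets.countable_UN image_subsetI) (simp_all add: X_def)
  also have "\<dots> \<le> (\<Sum>i. emeasure lborel (X i))"
    by (intro emeasure_subadditive_countably) (auto simp: X_def)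
  also have "\<dots> \<le> (\<Sum>i. ennreal (10 / A) * emeasure \<nu> (Y i))"
  proof (intro suminf_le summableI)
    fix i
    show "emeasure lborel (X i) \<le> ennreal (10 / A) * emeasure \<nu> (Y i)"
    proof (cases "i \<in> k ` C")
      case True
      have R: "0 < r (c i)" using r cC True by blast
      have "emeasure lborel (X i) = ennreal (10 * r (c i))"
        using True R by (simp add: X_def ball_eq_greaterThanLessThan)
      also have "\<dots> = ennreal (10 / A) * ennreal (A * r (c i))"
        using A R by (simp flip: ennreal_mult)
      also have "\<dots> \<le> ennreal (10 / A) * emeasure \<nu> (Y i)"
        using r(2)[OF cC(1)[OF True]] True by (intro mult_left_mono) (auto simp: Y_def)
      finally show ?thesis .
    qed (simp add: X_def)
  qed
  also have "\<dots> = ennreal (10 / A) * (\<Sum>i. emeasure \<nu> (Y i))"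
    by simp
  also have "(\<Sum>i. emeasure \<nu> (Y i)) = emeasure \<nu> (\<Union>i. Y i)"
  proof (rule suminf_emeasure)
    show "range Y \<subseteq> sets \<nu>" by (auto simp: Y_def sets)
    show "disjoint_family Y"
      unfolding disjoint_family_on_def
    proof (intro ballI impI)
      fix m n :: nat assume "m \<noteq> n"
      show "Y m \<inter> Y n = {}"
      proof (cases "m \<in> k ` C \<and> n \<in> k ` C")
        case True
        then have "c m \<noteq> c n" using \<open>m \<noteq> n\<close> ck by auto
        then show ?thesis using C(3) cC(2) True by (auto simp: Y_def pairwise_def disjnt_def)
      qed (auto simp: Y_def)
    qed
  qed
  also have "ennreal (10 / A) * emeasure \<nu> (\<Union>i. Y i) \<le> ennreal (10 / A) * emeasure \<nu> UNIV"
    by (intro mult_left_mono emeasure_mono) (auto simp: sets)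
  finally show ?thesis .
qed

text \<open>
  The Poisson kernel is at most a sum of multiples of indicators of the dyadic balls of radius
  \<open>2\<^sup>k y\<close>, with coefficients of order \<open>4\<^bsup>-k\<^esup> / y\<close>; the averages over these balls then contribute a
  geometric series.
\<close>

lemma poisson_integral_le_of_averages:
  fixes \<nu> :: "real measure"
  assumes sets: "sets \<nu> = sets borel" and A: "0 \<le> A" and y: "0 < y"
    and small: "\<And>r. 0 < r \<Longrightarrow> emeasure \<nu> (cball x r) \<le> ennreal (A * r)"
  shows "(\<integral>\<^sup>+t. ennreal (y / ((t - x)\<^sup>2 + y\<^sup>2)) \<partial>\<nu>) \<le> ennreal (8 * A)"
proof -
  have [measurable_cong]: "sets \<nu> = sets borel" by (rule sets)
  let ?c = "\<lambda>k::nat. 4 / (4 ^ k * y)"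
  have pointwise: "ennreal (y / ((t - x)\<^sup>2 + y\<^sup>2)) \<le> (\<Sum>k. ennreal (?c k) * indicator (cball x (2 ^ k * y)) t)" for t
  proof -
    obtain k0 :: nat where "\<bar>t - x\<bar> / y < 2 ^ k0"
      using real_arch_pow[of 2 "\<bar>t - x\<bar> / y"] by auto
    then have ex: "\<bar>t - x\<bar> \<le> 2 ^ k0 * y" using y by (simp add: field_simps)
    define k where "k = (LEAST k. \<bar>t - x\<bar> \<le> 2 ^ k * y)"
    have k: "\<bar>t - x\<bar> \<le> 2 ^ k * y" unfolding k_def using ex by (rule LeastI)
    have "y / ((t - x)\<^sup>2 + y\<^sup>2) \<le> ?c k"
    proof (cases k)
      case 0
      have "y / ((t - x)\<^sup>2 + y\<^sup>2) \<le> y / y\<^sup>2"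
        using y by (intro divide_left_mono) (auto intro!: mult_pos_pos add_nonneg_pos)
      also have "\<dots> \<le> 4 / y" using y by (simp add: field_simps power2_eq_square)
      finally show ?thesis using 0 by simp
    next
      case (Suc m)
      then have "\<not> \<bar>t - x\<bar> \<le> 2 ^ m * y"
        using not_less_Least[of m "\<lambda>k. \<bar>t - x\<bar> \<le> 2 ^ k * y"] by (simp add: k_def)
      then have "(2 ^ m * y)\<^sup>2 \<le> \<bar>t - x\<bar>\<^sup>2"
        using y by (intro power_mono) auto
      then have *: "4 ^ m * y\<^sup>2 \<le> (t - x)\<^sup>2"
        using power_mult_distrib[of "2::real" 2 m] by (simp add: power_mult_distrib power2_eq_square ac_simps)
      have "y / ((t - x)\<^sup>2 + y\<^sup>2) \<le> y / (4 ^ m * y\<^sup>2)"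
        using y * by (intro divide_left_mono) (auto intro!: mult_pos_pos add_nonneg_pos intro: add_increasing2)
      also have "\<dots> = ?c k" using y Suc by (simp add: field_simps power2_eq_square)
      finally show ?thesis .
    qed
    then have "ennreal (y / ((t - x)\<^sup>2 + y\<^sup>2)) \<le> ennreal (?c k) * indicator (cball x (2 ^ k * y)) t"
      using k by (auto simp: dist_real_def abs_minus_commute intro!: ennreal_leI split: split_indicator)
    also have "\<dots> = (\<Sum>j\<in>{k}. ennreal (?c j) * indicator (cball x (2 ^ j * y)) t)"
      by (subst sum.insert) auto
    also have "\<dots> \<le> (\<Sum>k. ennreal (?c k) * indicator (cball x (2 ^ k * y)) t)"
      by (rule sum_le_suminf) (auto intro: summableI)
    finally show ?thesis .
  qed
  have "(\<integral>\<^sup>+t. ennreal (y / ((t - x)\<^sup>2 + y\<^sup>2)) \<partial>\<nu>) \<le>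
      (\<integral>\<^sup>+t. (\<Sum>k. ennreal (?c k) * indicator (cball x (2 ^ k * y)) t) \<partial>\<nu>)"
    by (intro nn_integral_mono pointwise)
  also have "\<dots> = (\<Sum>k. \<integral>\<^sup>+t. ennreal (?c k) * indicator (cball x (2 ^ k * y)) t \<partial>\<nu>)"
    by (rule nn_integral_suminf) (intro borel_measurable_times_ennreal borel_measurable_const borel_measurable_indicator, simp add: sets)
  also have "\<dots> \<le> (\<Sum>k. ennreal (8 * A * (1 / 2) ^ Suc k))"
  proof (intro suminf_le summableI)
    fix k
    have "(\<integral>\<^sup>+t. ennreal (?c k) * indicator (cball x (2 ^ k * y)) t \<partial>\<nu>) = ennreal (?c k) * emeasure \<nu> (cball x (2 ^ k * y))"
      by (rule nn_integral_cmult_indicator) (simp add: sets)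
    also have "\<dots> \<le> ennreal (?c k) * ennreal (A * (2 ^ k * y))"
      using y by (intro mult_left_mono small) auto
    also have "\<dots> = ennreal (?c k * (A * (2 ^ k * y)))"
      using y A by (simp flip: ennreal_mult)
    also have "?c k * (A * (2 ^ k * y)) = 8 * A * (1 / 2) ^ Suc k"
    proof -
      have "(4::real) ^ k = 2 ^ k * 2 ^ k" by (simp flip: power_mult_distrib)
      then show ?thesis using y by (simp add: field_simps)
    qed
    finally show "(\<integral>\<^sup>+t. ennreal (?c k) * indicator (cball x (2 ^ k * y)) t \<partial>\<nu>) \<le> ennreal (8 * A * (1 / 2) ^ Suc k)" .
  qed
  also have "\<dots> = ennreal (8 * A)"
    using sums_mult[OF power_half_series, of "8 * A"] A
    by (intro suminf_ennreal_eq) auto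
  finally show ?thesis .
qed

section \<open>Hardy space functions on horizontal lines\<close>

definition hardy_norm_sq_real :: "(complex \<Rightarrow> complex) \<Rightarrow> real" where
  "hardy_norm_sq_real F = enn2real (hardy_norm_sq F)"

definition line_norm_sq :: "(complex \<Rightarrow> complex) \<Rightarrow> real \<Rightarrow> real" where
  "line_norm_sq F y = (LINT x|lborel. (cmod (F (Complex x y)))\<^sup>2)"

lemma open_upper_half_plane: "open upper_half_plane"
  unfolding upper_half_plane_def by (rule open_halfspace_Im_gt)

lemma Complex_in_upper_half_plane [simp]: "Complex x y \<in> upper_half_plane \<longleftrightarrow> 0 < y"
  by (simp add: upper_half_plane_def)

lemma hardy_holomorphic: "F \<in> hardy_space \<Longrightarrow> F holomorphic_on upper_half_plane"
  by (simp add: hardy_space_def)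

lemma hardy_continuous: "F \<in> hardy_space \<Longrightarrow> continuous_on upper_half_plane F"
  by (simp add: hardy_holomorphic holomorphic_on_imp_continuous_on)

lemma hardy_line_measurable:
  assumes "F \<in> hardy_space" "0 < y"
  shows "(\<lambda>x. F (Complex x y)) \<in> borel_measurable borel"
  using assms by (intro measurable_line[OF hardy_continuous]) auto

lemma hardy_line_nn_integral_le:
  assumes "F \<in> hardy_space" "0 < y"
  shows "(\<integral>\<^sup>+x. ennreal ((cmod (F (Complex x y)))\<^sup>2) \<partial>lborel) \<le> ennreal (hardy_norm_sq_real F)"
proof -
  have "hardy_norm_sq F < \<infinity>" using assms by (simp add: hardy_space_def)
  then have "ennreal (hardy_norm_sq_real F) = hardy_norm_sq F" by (simp add: hardy_norm_sq_real_def)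
  then show ?thesis using assms by (auto simp: hardy_norm_sq_def intro: SUP_upper)
qed

lemma hardy_norm_sq_real_nonneg: "0 \<le> hardy_norm_sq_real F"
  by (simp add: hardy_norm_sq_real_def)

lemma hardy_line_integrable:
  assumes "F \<in> hardy_space" "0 < y"
  shows "integrable lborel (\<lambda>x. (cmod (F (Complex x y)))\<^sup>2)"
proof -
  note hardy_line_measurable[OF assms, measurable]
  show ?thesis
    using le_less_trans[OF hardy_line_nn_integral_le[OF assms]] by (simp add: integrable_iff_bounded)
qed

lemma line_norm_sq_nonneg: "0 \<le> line_norm_sq F y"
  by (simp add: line_norm_sq_def)

lemma hardy_line_nn_integral:
  assumes "F \<in> hardy_space" "0 < y"
  shows "(\<integral>\<^sup>+x. ennreal ((cmod (F (Complex x y)))\<^sup>2) \<partial>lborel) = ennreal (line_norm_sq F y)"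
  unfolding line_norm_sq_def using hardy_line_integrable[OF assms]
  by (intro nn_integral_eq_integral) auto

lemma line_norm_sq_le_hardy_norm_sq_real:
  assumes "F \<in> hardy_space" "0 < y"
  shows "line_norm_sq F y \<le> hardy_norm_sq_real F"
  using hardy_line_nn_integral_le[OF assms] hardy_line_nn_integral[OF assms]
  by (simp add: hardy_norm_sq_real_nonneg)

lemma hardy_spaceI:
  assumes "F holomorphic_on upper_half_plane" "0 \<le> C"
    and "\<And>y. 0 < y \<Longrightarrow> (\<integral>\<^sup>+x. ennreal ((cmod (F (Complex x y)))\<^sup>2) \<partial>lborel) \<le> ennreal C"
  shows "F \<in> hardy_space" "hardy_norm_sq_real F \<le> C"
proof -
  have le: "hardy_norm_sq F \<le> ennreal C"
    unfolding hardy_norm_sq_def by (rule SUP_least) (use assms(3) in auto)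
  show "F \<in> hardy_space"
    using le_less_trans[OF le] assms(1) by (simp add: hardy_space_def)
  show "hardy_norm_sq_real F \<le> C"
    unfolding hardy_norm_sq_real_def using le assms(2) by (rule enn2real_leI[rotated])
qed

text \<open>
  This weighted arithmetic-geometric mean inequality stands in for Cauchy--Schwarz: the
  free parameter \<open>s\<close> can be chosen afterwards to balance the two terms.
\<close>

lemma cmod_mult_le_sum_squares:
  assumes "0 < s"
  shows "cmod (a * b) \<le> (cmod a)\<^sup>2 / s + s * (cmod b)\<^sup>2"
proof -
  have "0 \<le> (cmod a / s - cmod b)\<^sup>2" by simp
  then have "2 * cmod a * cmod b / s \<le> (cmod a / s)\<^sup>2 + (cmod b)\<^sup>2"
    by (simp add: power2_diff field_simps)
  then have "2 * cmod a * cmod b \<le> ((cmod a / s)\<^sup>2 + (cmod b)\<^sup>2) * s"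
    using assms by (simp add: field_simps)
  also have "\<dots> = (cmod a)\<^sup>2 / s + s * (cmod b)\<^sup>2"
    using assms by (simp add: field_simps power2_eq_square)
  finally have "2 * (cmod a * cmod b) \<le> (cmod a)\<^sup>2 / s + s * (cmod b)\<^sup>2" by simp
  moreover have "0 \<le> cmod a * cmod b" by simp
  ultimately show ?thesis unfolding norm_mult by linarith
qed

lemma integrable_mult_cnj:
  fixes f g :: "'a \<Rightarrow> complex"
  assumes [measurable]: "f \<in> borel_measurable M" "g \<in> borel_measurable M"
    and f: "integrable M (\<lambda>x. (cmod (f x))\<^sup>2)" and g: "integrable M (\<lambda>x. (cmod (g x))\<^sup>2)"
  shows "integrable M (\<lambda>x. f x * cnj (g x))"
proof (rule Bochner_Integration.integrable_bound)
  show "integrable M (\<lambda>x. (cmod (f x))\<^sup>2 + (cmod (g x))\<^sup>2)" using f g by simp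
  show "AE x in M. norm (f x * cnj (g x)) \<le> norm ((cmod (f x))\<^sup>2 + (cmod (g x))\<^sup>2)"
  proof (rule AE_I2)
    fix x
    show "norm (f x * cnj (g x)) \<le> norm ((cmod (f x))\<^sup>2 + (cmod (g x))\<^sup>2)"
      using cmod_mult_le_sum_squares[of 1 "f x" "cnj (g x)"] by simp
  qed
  have [measurable]: "cnj \<in> borel_measurable borel"
    by (intro borel_measurable_continuous_onI continuous_intros)
  show "(\<lambda>x. f x * cnj (g x)) \<in> borel_measurable M" by measurable
qed

lemma holomorphic_reflection:
  assumes "F holomorphic_on upper_half_plane"
  shows "(\<lambda>z. cnj (F (cnj z + \<i> * of_real s))) holomorphic_on {z. Im z < s}"
proof -
  have "(\<lambda>z. F (z + \<i> * of_real s)) holomorphic_on cnj ` {z. Im z < s}"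
    by (rule holomorphic_on_compose_gen[of "\<lambda>z. z + \<i> * of_real s" _ F upper_half_plane, unfolded o_def])
      (use assms in \<open>auto intro!: holomorphic_intros simp: upper_half_plane_def\<close>)
  then have "cnj \<circ> (\<lambda>z. F (z + \<i> * of_real s)) \<circ> cnj holomorphic_on {z. Im z < s}"
    by (rule holomorphic_on_compose_cnj_cnj) (rule open_halfspace_Im_lt)
  then show ?thesis by (simp add: o_def)
qed

text \<open>
  On the line of height \<open>y\<close> the function \<open>F z * cnj (F (cnj z + i s))\<close> equals \<open>F (x + i y) * cnj (F (x + i (s - y)))\<close>.
  It is holomorphic for \<open>0 < Im z < s\<close>, so its integral is the same at the height \<open>y1\<close> and at the
  symmetric height \<open>s / 2\<close>.
\<close>

lemma line_inner_product_eq_midpoint: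
  assumes F: "F \<in> hardy_space" and y: "0 < y1" "y1 \<le> y2"
  shows "(LINT x|lborel. F (Complex x y1) * cnj (F (Complex x y2))) =
    of_real (line_norm_sq F ((y1 + y2) / 2))"
proof -
  define s where "s = y1 + y2"
  define H where "H = (\<lambda>z. F z * cnj (F (cnj z + \<i> * of_real s)))"
  have H_line: "H (Complex x y) = F (Complex x y) * cnj (F (Complex x (s - y)))" for x y
    by (simp add: H_def Complex_eq algebra_simps)
  have "(LINT x|lborel. H (Complex x y1)) = (LINT x|lborel. H (Complex x (s / 2)))"
  proof (rule line_integral_shift[where S = "{z. 0 < Im z} \<inter> {z. Im z < s}" and C = "hardy_norm_sq_real F + hardy_norm_sq_real F"])
    show "open ({z. 0 < Im z} \<inter> {z. Im z < s})"
      by (intro open_Int open_halfspace_Im_gt open_halfspace_Im_lt)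
    show "convex ({z. 0 < Im z} \<inter> {z. Im z < s})"
      by (intro convex_Int convex_halfspace_Im_gt convex_halfspace_Im_lt)
    have "F holomorphic_on {z. 0 < Im z} \<inter> {z. Im z < s}"
      by (rule holomorphic_on_subset[OF hardy_holomorphic[OF F]]) (auto simp: upper_half_plane_def)
    moreover have "(\<lambda>z. cnj (F (cnj z + \<i> * of_real s))) holomorphic_on {z. 0 < Im z} \<inter> {z. Im z < s}"
      by (rule holomorphic_on_subset[OF holomorphic_reflection[OF hardy_holomorphic[OF F]]]) auto
    ultimately show "H holomorphic_on {z. 0 < Im z} \<inter> {z. Im z < s}"
      unfolding H_def by (rule holomorphic_on_mult)
    show "{z. y1 \<le> Im z \<and> Im z \<le> s / 2} \<subseteq> {z. 0 < Im z} \<inter> {z. Im z < s}" "y1 \<le> s / 2"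
      using y by (auto simp: s_def)
  next
    fix y assume "y1 \<le> y" "y \<le> s / 2"
    then have y': "0 < y" "0 < s - y" using y by (auto simp: s_def)
    note hardy_line_measurable[OF F y'(1), measurable] hardy_line_measurable[OF F y'(2), measurable]
    have "(\<integral>\<^sup>+x. ennreal (cmod (H (Complex x y))) \<partial>lborel) \<le>
        (\<integral>\<^sup>+x. ennreal ((cmod (F (Complex x y)))\<^sup>2) + ennreal ((cmod (F (Complex x (s - y))))\<^sup>2) \<partial>lborel)"
    proof (rule nn_integral_mono)
      fix x
      show "ennreal (cmod (H (Complex x y))) \<le> ennreal ((cmod (F (Complex x y)))\<^sup>2) + ennreal ((cmod (F (Complex x (s - y))))\<^sup>2)"
        using cmod_mult_le_sum_squares[of 1 "F (Complex x y)" "cnj (F (Complex x (s - y)))"]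
        by (simp add: H_line flip: ennreal_plus)
    qed
    also have "\<dots> = (\<integral>\<^sup>+x. ennreal ((cmod (F (Complex x y)))\<^sup>2) \<partial>lborel) + (\<integral>\<^sup>+x. ennreal ((cmod (F (Complex x (s - y))))\<^sup>2) \<partial>lborel)"
      by (rule nn_integral_add) measurable
    also have "\<dots> \<le> ennreal (hardy_norm_sq_real F) + ennreal (hardy_norm_sq_real F)"
      by (intro add_mono hardy_line_nn_integral_le F y')
    finally show "(\<integral>\<^sup>+x. ennreal (cmod (H (Complex x y))) \<partial>lborel) \<le> ennreal (hardy_norm_sq_real F + hardy_norm_sq_real F)"
      by (subst ennreal_plus) (simp_all add: hardy_norm_sq_real_nonneg)
  qed
  moreover have "H (Complex x (s / 2)) = of_real ((cmod (F (Complex x (s / 2))))\<^sup>2)" for x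
    by (simp only: complex_norm_square) (simp add: H_line)
  moreover have "s - y1 = y2" by (simp add: s_def)
  ultimately show ?thesis
    by (simp add: H_line line_norm_sq_def s_def del: of_real_power)
qed

text \<open>
  Expanding the square produces the real part of the inner product of the two restrictions, which
  is known from the midpoint formula.
\<close>

lemma line_distance_sq_eq:
  assumes F: "F \<in> hardy_space" and y: "0 < y1" "0 < y2"
  shows "integrable lborel (\<lambda>x. (cmod (F (Complex x y1) - F (Complex x y2)))\<^sup>2)" (is ?int)
    and "(LINT x|lborel. (cmod (F (Complex x y1) - F (Complex x y2)))\<^sup>2) =
      line_norm_sq F y1 + line_norm_sq F y2 - 2 * line_norm_sq F ((y1 + y2) / 2)" (is ?eq)
proof -
  have *: "integrable lborel (\<lambda>x. (cmod (F (Complex x y1) - F (Complex x y2)))\<^sup>2) \<and>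
      (LINT x|lborel. (cmod (F (Complex x y1) - F (Complex x y2)))\<^sup>2) =
      line_norm_sq F y1 + line_norm_sq F y2 - 2 * line_norm_sq F ((y1 + y2) / 2)"
    if y: "0 < y1" "y1 \<le> y2" for y1 y2
  proof -
    have y': "0 < y2" using y by simp
    have expand: "(cmod (a - b))\<^sup>2 = (cmod a)\<^sup>2 + (cmod b)\<^sup>2 - 2 * Re (a * cnj b)" for a b
      unfolding cmod_power2 by (simp add: power2_eq_square algebra_simps)
    note i = hardy_line_integrable[OF F y(1)] hardy_line_integrable[OF F y']
    have ip: "integrable lborel (\<lambda>x. F (Complex x y1) * cnj (F (Complex x y2)))"
      using hardy_line_measurable[OF F y(1)] hardy_line_measurable[OF F y'] i
      by (intro integrable_mult_cnj) auto
    define p where "p = (\<lambda>x. Re (F (Complex x y1) * cnj (F (Complex x y2))))"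
    have "integrable lborel p" and "(LINT x|lborel. p x) = line_norm_sq F ((y1 + y2) / 2)"
      using integrable_Re[OF ip] integral_Re[OF ip] line_inner_product_eq_midpoint[OF F y]
      unfolding p_def by simp_all
    moreover have "(cmod (F (Complex x y1) - F (Complex x y2)))\<^sup>2 =
        (cmod (F (Complex x y1)))\<^sup>2 + (cmod (F (Complex x y2)))\<^sup>2 - 2 * p x" for x
      unfolding p_def by (rule expand)
    ultimately show ?thesis using i by (simp add: line_norm_sq_def)
  qed
  show ?int using *[of y1 y2] *[of y2 y1] y by (cases "y1 \<le> y2") (auto simp: norm_minus_commute)
  show ?eq using *[of y1 y2] *[of y2 y1] y by (cases "y1 \<le> y2") (auto simp: norm_minus_commute add.commute)
qed

text \<open>
  The distance formula makes the squared norm \<open>N\<close> midpoint convex. If \<open>N b > N a\<close> with \<open>a < b\<close>, its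
  increments along the progression \<open>a, b, a + 2 d, \<dots>\<close> with \<open>d = b - a\<close> never shrink, so \<open>N\<close> would be unbounded.
\<close>

lemma line_norm_sq_antimono:
  assumes F: "F \<in> hardy_space" and y: "0 < a" "a \<le> b"
  shows "line_norm_sq F b \<le> line_norm_sq F a"
proof (rule ccontr)
  let ?N = "line_norm_sq F"
  assume "\<not> ?thesis"
  then have lt: "?N a < ?N b" by simp
  define d where "d = b - a"
  have "0 < d" using lt y by (cases "a = b") (auto simp: d_def)
  have convex: "2 * ?N ((u + v) / 2) \<le> ?N u + ?N v" if "0 < u" "0 < v" for u v
  proof -
    have "0 \<le> (LINT x|lborel. (cmod (F (Complex x u) - F (Complex x v)))\<^sup>2)" by simp
    then show ?thesis using line_distance_sq_eq(2)[OF F that] by simp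
  qed
  \<comment> \<open>Convexity at the midpoint of two successive steps: increments do not shrink.\<close>
  have step: "?N b - ?N a \<le> ?N (a + real (Suc k) * d) - ?N (a + real k * d)" for k
  proof (induction k)
    case 0
    then show ?case by (simp add: d_def)
  next
    case (Suc k)
    have "0 < a + real j * d" for j using y \<open>0 < d\<close> by (simp add: add_pos_nonneg)
    from convex[OF this[of k] this[of "Suc (Suc k)"]]
    have "2 * ?N (a + real (Suc k) * d) \<le> ?N (a + real k * d) + ?N (a + real (Suc (Suc k)) * d)"
      by (simp add: field_simps add_divide_distrib)
    then show ?case using Suc by linarith
  qed
  have grow: "?N a + real k * (?N b - ?N a) \<le> ?N (a + real k * d)" for k
  proof (induction k)
    case (Suc k)
    then show ?case using step[of k] by (simp add: algebra_simps)
  qed simp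
  obtain k :: nat where k: "hardy_norm_sq_real F < real k * (?N b - ?N a)"
    using reals_Archimedean3[of "?N b - ?N a"] lt by auto
  have "0 < a + real k * d" using y \<open>0 < d\<close> by (simp add: add_pos_nonneg)
  from line_norm_sq_le_hardy_norm_sq_real[OF F this] grow[of k] line_norm_sq_nonneg[of F a] k
  show False by linarith
qed

lemma line_norm_sq_tendsto:
  assumes F: "F \<in> hardy_space"
  shows "(line_norm_sq F \<longlongrightarrow> hardy_norm_sq_real F) (at_right 0)"
proof (rule order_tendstoI)
  fix c assume "hardy_norm_sq_real F < c"
  then show "eventually (\<lambda>y. line_norm_sq F y < c) (at_right 0)"
    using line_norm_sq_le_hardy_norm_sq_real[OF F] le_less_trans
    by (intro eventually_mono[OF eventually_at_right_less[of "0::real"]]) blast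
next
  fix c assume c: "c < hardy_norm_sq_real F"
  have "\<exists>y>0. c < line_norm_sq F y"
  proof (rule ccontr)
    assume "\<not> (\<exists>y>0. c < line_norm_sq F y)"
    then have le: "line_norm_sq F y \<le> c" if "0 < y" for y using that by auto
    have "0 \<le> c" using le[of 1] line_norm_sq_nonneg[of F 1] by simp
    moreover have "(\<integral>\<^sup>+x. ennreal ((cmod (F (Complex x y)))\<^sup>2) \<partial>lborel) \<le> ennreal c" if "0 < y" for y
      using hardy_line_nn_integral[OF F that] le[OF that] by (simp add: ennreal_leI)
    ultimately have "hardy_norm_sq_real F \<le> c" by (rule hardy_spaceI(2)[OF hardy_holomorphic[OF F]])
    then show False using c by simp
  qed
  then obtain y where y: "0 < y" "c < line_norm_sq F y" by blast
  show "eventually (\<lambda>y. c < line_norm_sq F y) (at_right 0)"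
    using eventually_at_right_real[OF y(1)]
  proof eventually_elim
    case (elim t)
    then show ?case using line_norm_sq_antimono[OF F, of t y] y(2) by simp
  qed
qed

text \<open>
  Writing \<open>N\<close> for the squared norm of \<open>F\<close> on lines, the distance formula gives the difference the squared norm
  \<open>N y + N (y + e) - 2 N (y + e / 2) \<le> \<parallel>F\<parallel>\<^sup>2 - N (y + e / 2)\<close> at height \<open>y\<close>. For \<open>y \<le> e / 2\<close> this is at most
  \<open>\<parallel>F\<parallel>\<^sup>2 - N e\<close>, and greater heights are covered by monotonicity for the difference itself.
\<close>

lemma hardy_vertical_difference:
  assumes F: "F \<in> hardy_space" and e: "0 < e"
  shows "(\<lambda>z. F z - F (z + \<i> * of_real e)) \<in> hardy_space" (is "?G \<in> _")
    and "hardy_norm_sq_real (\<lambda>z. F z - F (z + \<i> * of_real e)) \<le> hardy_norm_sq_real F - line_norm_sq F e"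
proof -
  have line: "?G (Complex x y) = F (Complex x y) - F (Complex x (y + e))" for x y
    by (simp add: Complex_eq algebra_simps)
  have val: "line_norm_sq ?G y = line_norm_sq F y + line_norm_sq F (y + e) - 2 * line_norm_sq F (y + e / 2)"
    and nn: "(\<integral>\<^sup>+x. ennreal ((cmod (?G (Complex x y)))\<^sup>2) \<partial>lborel) = ennreal (line_norm_sq ?G y)"
    if "0 < y" for y
  proof -
    have mid: "(y + (y + e)) / 2 = y + e / 2" by (simp add: field_simps)
    from line_distance_sq_eq(2)[OF F that, of "y + e", unfolded mid] that e
    show "line_norm_sq ?G y = line_norm_sq F y + line_norm_sq F (y + e) - 2 * line_norm_sq F (y + e / 2)"
      unfolding line_norm_sq_def line by simp
    show "(\<integral>\<^sup>+x. ennreal ((cmod (?G (Complex x y)))\<^sup>2) \<partial>lborel) = ennreal (line_norm_sq ?G y)"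
      unfolding line_norm_sq_def line
      by (rule nn_integral_eq_integral, rule line_distance_sq_eq(1)[OF F that]) (use that e in auto)
  qed
  have le: "line_norm_sq ?G y \<le> hardy_norm_sq_real F - line_norm_sq F (y + e / 2)" if "0 < y" for y
    using val[OF that] line_norm_sq_le_hardy_norm_sq_real[OF F that]
      line_norm_sq_antimono[OF F, of "y + e / 2" "y + e"] that e by simp
  have "(\<lambda>z. F (z + \<i> * of_real e)) holomorphic_on upper_half_plane"
    by (rule holomorphic_on_compose_gen[of "\<lambda>z. z + \<i> * of_real e" _ F upper_half_plane, unfolded o_def])
      (use e hardy_holomorphic[OF F] in \<open>auto intro!: holomorphic_intros simp: upper_half_plane_def\<close>)
  then have holo: "?G holomorphic_on upper_half_plane"
    by (rule holomorphic_on_diff[OF hardy_holomorphic[OF F]])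
  show G: "?G \<in> hardy_space"
  proof (rule hardy_spaceI(1)[OF holo hardy_norm_sq_real_nonneg])
    fix y :: real assume "0 < y"
    then show "(\<integral>\<^sup>+x. ennreal ((cmod (?G (Complex x y)))\<^sup>2) \<partial>lborel) \<le> ennreal (hardy_norm_sq_real F)"
      using nn le[of y] line_norm_sq_nonneg[of F "y + e / 2"] by (simp add: ennreal_leI)
  qed
  show "hardy_norm_sq_real ?G \<le> hardy_norm_sq_real F - line_norm_sq F e"
  proof (rule hardy_spaceI(2)[OF holo])
    show "0 \<le> hardy_norm_sq_real F - line_norm_sq F e"
      using line_norm_sq_le_hardy_norm_sq_real[OF F e] by simp
    fix y :: real assume y: "0 < y"
    \<comment> \<open>Lowering the line to height at most \<open>e / 2\<close> keeps \<open>y + e / 2\<close> below \<open>e\<close>.\<close>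
    have "line_norm_sq ?G y \<le> line_norm_sq ?G (min y (e / 2))"
      using y e by (intro line_norm_sq_antimono[OF G]) auto
    also have "\<dots> \<le> hardy_norm_sq_real F - line_norm_sq F (min y (e / 2) + e / 2)"
      using y e by (intro le) auto
    also have "\<dots> \<le> hardy_norm_sq_real F - line_norm_sq F e"
      using line_norm_sq_antimono[OF F, of "min y (e / 2) + e / 2" e] y e by auto
    finally show "(\<integral>\<^sup>+x. ennreal ((cmod (?G (Complex x y)))\<^sup>2) \<partial>lborel) \<le> ennreal (hardy_norm_sq_real F - line_norm_sq F e)"
      using nn[OF y] by (simp add: ennreal_leI)
  qed
qed

section \<open>Cauchy and Poisson formulas on horizontal lines\<close>

text \<open>
  Here \<open>H = f / (z - p)\<close> with any zero of the denominator removed. The line integrals of \<open>|H|\<close> are bounded, because \<open>H\<close> is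
  bounded near \<open>p\<close> and elsewhere \<open>|f / (z - p)| \<le> |f|\<^sup>2 + 1 / |z - p|\<^sup>2\<close>; so the line may be moved upwards.
  At height \<open>Im p + s\<^sup>2\<close> the same estimate, weighted with \<open>s\<close>, bounds the integral by \<open>(M + \<pi>) / s\<close>.
\<close>

lemma line_integral_quotient_eq_0:
  fixes H f :: "complex \<Rightarrow> complex"
  assumes a: "a < e" and H: "H holomorphic_on {z. a < Im z}"
    and f: "\<And>z. a < Im z \<Longrightarrow> H z * (z - p) = f z"
    and M: "0 \<le> M" "\<And>y. e \<le> y \<Longrightarrow> (\<integral>\<^sup>+t. ennreal ((cmod (f (Complex t y)))\<^sup>2) \<partial>lborel) \<le> ennreal M"
  shows "integrable lborel (\<lambda>t. H (Complex t e))" "(LINT t|lborel. H (Complex t e)) = 0"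
proof -
  have contH: "continuous_on {z. a < Im z} H" using H by (rule holomorphic_on_imp_continuous_on)
  have mH: "(\<lambda>t. H (Complex t y)) \<in> borel_measurable borel" if "e \<le> y" for y
    by (rule measurable_line[OF contH]) (use that a in auto)
  have mf: "(\<lambda>t. f (Complex t y)) \<in> borel_measurable borel" if "e \<le> y" for y
  proof -
    have "(\<lambda>t. H (Complex t y) * (Complex t y - p)) \<in> borel_measurable borel"
      by (intro borel_measurable_times mH that borel_measurable_continuous_onI continuous_intros)
    moreover have "H (Complex t y) * (Complex t y - p) = f (Complex t y)" for t
      using that a by (intro f) simp
    ultimately show ?thesis by simp
  qed
  \<comment> \<open>Only the part of the disc above the line matters, where \<open>H\<close> is continuous up to the boundary.\<close>
  define K where "K = cball p 1 \<inter> {z. e \<le> Im z}"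
  have "compact K" unfolding K_def
    by (intro compact_Int_closed compact_cball closed_halfspace_Im_ge)
  moreover have "continuous_on K H"
    by (rule continuous_on_subset[OF contH]) (use a in \<open>auto simp: K_def\<close>)
  ultimately have "bounded (H ` K)"
    by (intro compact_imp_bounded compact_continuous_image)
  then obtain B where B: "0 < B" "\<And>z. z \<in> K \<Longrightarrow> cmod (H z) \<le> B"
    by (auto simp: bounded_pos)
  have H_eq: "cmod (H z) = cmod (f z * inverse (z - p))" if "e \<le> Im z" "z \<noteq> p" for z
  proof -
    have "f z = H z * (z - p)" using f[of z] that a by simp
    then show ?thesis using that by (simp add: mult.assoc)
  qed
  have norm_diff: "(cmod (Complex t y - p))\<^sup>2 = (t - Re p)\<^sup>2 + (y - Im p)\<^sup>2" for t y
    by (simp add: cmod_power2)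
  have H_bound: "cmod (H (Complex t y)) \<le> (cmod (f (Complex t y)))\<^sup>2 + (2 + 2 * B) * (1 / ((t - Re p)\<^sup>2 + 1\<^sup>2))"
    if y: "e \<le> y" for t y
  proof (cases "cmod (Complex t y - p) \<le> 1")
    case True
    then have "Complex t y \<in> K" using y by (simp add: K_def dist_norm norm_minus_commute)
    from B(2)[OF this] have "cmod (H (Complex t y)) \<le> B" .
    have "(t - Re p)\<^sup>2 \<le> (cmod (Complex t y - p))\<^sup>2" unfolding norm_diff by simp
    also have "\<dots> \<le> 1" using True by (simp add: power_le_one)
    finally have "1 / 2 \<le> 1 / ((t - Re p)\<^sup>2 + 1\<^sup>2)"
      by (intro divide_left_mono) (auto intro!: mult_pos_pos add_nonneg_pos)
    then have "(2 + 2 * B) * (1 / 2) \<le> (2 + 2 * B) * (1 / ((t - Re p)\<^sup>2 + 1\<^sup>2))"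
      using B(1) by (intro mult_left_mono) auto
    moreover have "B \<le> (2 + 2 * B) * (1 / 2)" by simp
    moreover have "0 \<le> (cmod (f (Complex t y)))\<^sup>2" by simp
    ultimately show ?thesis using \<open>cmod (H (Complex t y)) \<le> B\<close> by linarith
  next
    case False
    define w where "w = Complex t y - p"
    have w: "1 < cmod w" using False by (simp add: w_def)
    then have "1 < (cmod w)\<^sup>2" by (simp add: one_less_power)
    moreover have "(t - Re p)\<^sup>2 \<le> (cmod w)\<^sup>2" unfolding w_def norm_diff by simp
    ultimately have *: "(t - Re p)\<^sup>2 + 1\<^sup>2 \<le> 2 * (cmod w)\<^sup>2" by simp
    have "Complex t y \<noteq> p" using w by (auto simp: w_def)
    then have "cmod (H (Complex t y)) = cmod (f (Complex t y) * inverse w)"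
      using H_eq y by (simp add: w_def)
    also have "\<dots> \<le> (cmod (f (Complex t y)))\<^sup>2 / 1 + 1 * (cmod (inverse w))\<^sup>2"
      by (rule cmod_mult_le_sum_squares) simp
    also have "(cmod (inverse w))\<^sup>2 = 2 / (2 * (cmod w)\<^sup>2)"
      by (simp add: inverse_eq_divide norm_divide power_divide)
    also have "\<dots> \<le> 2 / ((t - Re p)\<^sup>2 + 1\<^sup>2)"
      using * w by (intro divide_left_mono) (auto intro!: mult_pos_pos add_nonneg_pos)
    also have "\<dots> \<le> (2 + 2 * B) * (1 / ((t - Re p)\<^sup>2 + 1\<^sup>2))"
      using B(1) by (simp add: divide_right_mono)
    finally show ?thesis by simp
  qed
  have sum_bound: "(\<integral>\<^sup>+t. ennreal (cmod (H (Complex t y))) \<partial>lborel) \<le> ennreal (M / s + c * (pi / u))"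
    if y: "e \<le> y" and "0 < s" "0 \<le> c" "0 < u"
      and le: "\<And>t. cmod (H (Complex t y)) \<le> (cmod (f (Complex t y)))\<^sup>2 / s + c * (1 / ((t - Re p)\<^sup>2 + u\<^sup>2))"
    for y s c u
  proof -
    note mf[OF y, measurable]
    have "(\<integral>\<^sup>+t. ennreal (cmod (H (Complex t y))) \<partial>lborel) \<le>
      (\<integral>\<^sup>+t. ennreal (1 / s) * ennreal ((cmod (f (Complex t y)))\<^sup>2) + ennreal c * ennreal (1 / ((t - Re p)\<^sup>2 + u\<^sup>2)) \<partial>lborel)"
    proof (rule nn_integral_mono)
      fix t
      have "ennreal (cmod (H (Complex t y))) \<le> ennreal ((cmod (f (Complex t y)))\<^sup>2 / s + c * (1 / ((t - Re p)\<^sup>2 + u\<^sup>2)))"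
        by (rule ennreal_leI[OF le])
      also have "\<dots> = ennreal (1 / s) * ennreal ((cmod (f (Complex t y)))\<^sup>2) + ennreal c * ennreal (1 / ((t - Re p)\<^sup>2 + u\<^sup>2))"
        using that by (simp flip: ennreal_mult ennreal_plus)
      finally show "ennreal (cmod (H (Complex t y))) \<le>
        ennreal (1 / s) * ennreal ((cmod (f (Complex t y)))\<^sup>2) + ennreal c * ennreal (1 / ((t - Re p)\<^sup>2 + u\<^sup>2))" .
    qed
    also have "\<dots> = ennreal (1 / s) * (\<integral>\<^sup>+t. ennreal ((cmod (f (Complex t y)))\<^sup>2) \<partial>lborel) +
        ennreal c * (\<integral>\<^sup>+t. ennreal (1 / ((t - Re p)\<^sup>2 + u\<^sup>2)) \<partial>lborel)"
      by (simp add: nn_integral_add nn_integral_cmult)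
    also have "\<dots> \<le> ennreal (1 / s) * ennreal M + ennreal c * ennreal (pi / u)"
      using that by (intro add_mono mult_left_mono M(2)) (simp_all add: poisson_kernel_nn_integral)
    also have "\<dots> = ennreal (M / s + c * (pi / u))"
      using that M(1) by (simp flip: ennreal_mult ennreal_plus)
    finally show ?thesis .
  qed
  have bound: "(\<integral>\<^sup>+t. ennreal (cmod (H (Complex t y))) \<partial>lborel) \<le> ennreal (M / 1 + (2 + 2 * B) * (pi / 1))" if "e \<le> y" for y
    using that B(1) H_bound by (intro sum_bound) auto
  have int: "integrable lborel (\<lambda>t. H (Complex t y))" if "e \<le> y" for y
    by (rule integrable_nn_bound[OF mH bound]) (use that in auto)
  show "integrable lborel (\<lambda>t. H (Complex t e))" by (rule int) simp
  define I where "I = (LINT t|lborel. H (Complex t e))"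
  have I_eq: "I = (LINT t|lborel. H (Complex t Y))" if "e \<le> Y" for Y
    unfolding I_def
    by (rule line_integral_shift[OF open_halfspace_Im_gt convex_halfspace_Im_gt H _ that bound])
      (use a in auto)
  have small: "cmod I * s \<le> M + pi" if s: "0 < s" "e \<le> Im p + s\<^sup>2" for s
  proof -
    define Y where "Y = Im p + s\<^sup>2"
    have Y: "e \<le> Y" using s by (simp add: Y_def)
    have "cmod (H (Complex t Y)) \<le> (cmod (f (Complex t Y)))\<^sup>2 / s + s * (1 / ((t - Re p)\<^sup>2 + (s\<^sup>2)\<^sup>2))" for t
    proof -
      define w where "w = Complex t Y - p"
      have "Complex t Y \<noteq> p" using s by (auto simp: Y_def complex_eq_iff)
      then have "cmod (H (Complex t Y)) = cmod (f (Complex t Y) * inverse w)"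
        using H_eq Y by (simp add: w_def)
      also have "\<dots> \<le> (cmod (f (Complex t Y)))\<^sup>2 / s + s * (cmod (inverse w))\<^sup>2"
        by (rule cmod_mult_le_sum_squares[OF s(1)])
      also have "(cmod (inverse w))\<^sup>2 = 1 / ((t - Re p)\<^sup>2 + (s\<^sup>2)\<^sup>2)"
        by (simp add: inverse_eq_divide norm_divide power_divide w_def norm_diff) (simp add: Y_def)
      finally show ?thesis .
    qed
    then have "(\<integral>\<^sup>+t. ennreal (cmod (H (Complex t Y))) \<partial>lborel) \<le> ennreal (M / s + s * (pi / s\<^sup>2))"
      using s Y by (intro sum_bound) auto
    moreover have "ennreal (cmod I) \<le> (\<integral>\<^sup>+t. ennreal (cmod (H (Complex t Y))) \<partial>lborel)"
      unfolding I_eq[OF Y] by (rule integral_norm_bound_ennreal[OF int[OF Y]])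
    ultimately have "ennreal (cmod I) \<le> ennreal (M / s + s * (pi / s\<^sup>2))" by (rule order_trans[rotated])
    then have "cmod I \<le> M / s + s * (pi / s\<^sup>2)"
      using M(1) s by (subst (asm) ennreal_le_iff) auto
    also have "\<dots> = (M + pi) / s" using s by (simp add: field_simps power2_eq_square)
    finally show ?thesis using s by (simp add: field_simps)
  qed
  show "(LINT t|lborel. H (Complex t e)) = 0"
  proof (rule ccontr)
    assume "(LINT t|lborel. H (Complex t e)) \<noteq> 0"
    then have "0 < cmod I" by (simp add: I_def)
    then obtain n :: nat where n: "M + pi < real n * cmod I"
      using reals_Archimedean3 by blast
    \<comment> \<open>The lower bound 1 ensures \<open>s \<le> s\<^sup>2\<close>, so the height \<open>Im p + s\<^sup>2\<close> is above the original line.\<close>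
    define s where "s = max 1 (max (real n) (e - Im p))"
    have "s \<le> s\<^sup>2" by (rule self_le_power) (simp_all add: s_def)
    moreover have "e - Im p \<le> s" by (simp add: s_def)
    ultimately have "e \<le> Im p + s\<^sup>2" by simp
    moreover have "0 < s" by (simp add: s_def)
    ultimately have "cmod I * s \<le> M + pi" by (intro small)
    moreover have "real n * cmod I \<le> s * cmod I" by (intro mult_right_mono) (auto simp: s_def)
    ultimately show False using n by (simp add: mult.commute)
  qed
qed

lemma line_cauchy_integral_below:
  assumes F: "F \<in> hardy_space" and e: "0 < e" "Im p < e"
  shows "integrable lborel (\<lambda>t. F (Complex t e) / (Complex t e - p))"
    and "(LINT t|lborel. F (Complex t e) / (Complex t e - p)) = 0"
proof -
  define a where "a = max 0 (Im p)"
  have a: "a < e" using e by (simp add: a_def)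
  have holo: "(\<lambda>z. F z / (z - p)) holomorphic_on {z. a < Im z}"
    by (intro holomorphic_intros holomorphic_on_subset[OF hardy_holomorphic[OF F]])
      (auto simp: a_def upper_half_plane_def)
  have eq: "F z / (z - p) * (z - p) = F z" if "a < Im z" for z
    using that by (auto simp: a_def)
  show "integrable lborel (\<lambda>t. F (Complex t e) / (Complex t e - p))"
    "(LINT t|lborel. F (Complex t e) / (Complex t e - p)) = 0"
    using line_integral_quotient_eq_0[OF a holo eq hardy_norm_sq_real_nonneg hardy_line_nn_integral_le[OF F]] e
    by auto
qed

text \<open>
  The pole at \<open>p\<close> is removed by subtracting \<open>F p * q\<close>, where \<open>q\<close> is square integrable on lines and \<open>q p = 1\<close>.
  Taking the pole \<open>p'\<close> of \<open>q\<close> to be the reflection of \<open>p\<close> in the line of integration turns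
  \<open>q / (z - p)\<close> into a multiple of the Poisson kernel, whose integral is known.
\<close>

lemma line_cauchy_integral_above:
  assumes F: "F \<in> hardy_space" and e: "0 < e" "e < Im p"
  shows "integrable lborel (\<lambda>t. F (Complex t e) / (Complex t e - p))"
    and "(LINT t|lborel. F (Complex t e) / (Complex t e - p)) = 2 * of_real pi * \<i> * F p"
proof -
  define u where "u = Im p - e"
  have u: "0 < u" using e by (simp add: u_def)
  define p' where "p' = Complex (Re p) (e - u)"
  \<comment> \<open>The half-plane \<open>Im z > a\<close> contains the line but not the pole \<open>p'\<close>, and \<open>F\<close> is holomorphic on it.\<close>
  define a where "a = max 0 (e - u)"
  have a: "a < e" using e u by (simp add: a_def)
  have pp': "p - p' = 2 * \<i> * of_real u" by (simp add: p'_def u_def complex_eq_iff)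
  define q where "q = (\<lambda>z. (p - p') / (z - p'))"
  have np': "z - p' \<noteq> 0" if "a < Im z" for z using that by (auto simp: p'_def a_def)
  have pS: "p \<in> {z. a < Im z}" using e u by (simp add: a_def)
  define f where "f = (\<lambda>z. F z - F p * q z)"
  have fp: "f p = 0" using np'[of p] pS by (simp add: f_def q_def)
  have holo_f: "f holomorphic_on {z. a < Im z}"
    unfolding f_def q_def
    by (intro holomorphic_intros holomorphic_on_subset[OF hardy_holomorphic[OF F]] np')
      (auto simp: a_def upper_half_plane_def)
  define H where "H = (\<lambda>z. if z = p then deriv f p else (f z - f p) / (z - p))"
  have holo: "H holomorphic_on {z. a < Im z}"
    unfolding H_def
    by (rule pole_lemma[OF holo_f]) (use pS in \<open>simp add: interior_open open_halfspace_Im_gt\<close>)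
  have eq: "H z * (z - p) = f z" for z by (simp add: H_def fp)
  define M where "M = 2 * hardy_norm_sq_real F + 2 * (cmod (F p))\<^sup>2 * (4 * u\<^sup>2 * (pi / u))"
  have M0: "0 \<le> M" using u by (simp add: M_def hardy_norm_sq_real_nonneg)
  have M: "(\<integral>\<^sup>+t. ennreal ((cmod (f (Complex t y)))\<^sup>2) \<partial>lborel) \<le> ennreal M" if y: "e \<le> y" for y
  proof -
    have y0: "0 < y" using e y by simp
    note hardy_line_measurable[OF F y0, measurable]
    let ?c = "2 * (cmod (F p))\<^sup>2 * (4 * u\<^sup>2)"
    have "(\<integral>\<^sup>+t. ennreal ((cmod (f (Complex t y)))\<^sup>2) \<partial>lborel) \<le>
      (\<integral>\<^sup>+t. ennreal 2 * ennreal ((cmod (F (Complex t y)))\<^sup>2) + ennreal ?c * ennreal (1 / ((t - Re p)\<^sup>2 + u\<^sup>2)) \<partial>lborel)"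
    proof (rule nn_integral_mono)
      fix t
      have "(cmod (A - B))\<^sup>2 \<le> 2 * (cmod A)\<^sup>2 + 2 * (cmod B)\<^sup>2" for A B
      proof -
        have "(cmod (A - B))\<^sup>2 \<le> (cmod A + cmod B)\<^sup>2"
          by (intro power_mono norm_triangle_ineq4 norm_ge_zero)
        also have "\<dots> \<le> 2 * (cmod A)\<^sup>2 + 2 * (cmod B)\<^sup>2"
          using sum_squares_bound[of "cmod A" "cmod B"] by (simp add: power2_sum)
        finally show ?thesis .
      qed
      then have "(cmod (f (Complex t y)))\<^sup>2 \<le> 2 * (cmod (F (Complex t y)))\<^sup>2 + 2 * (cmod (F p * q (Complex t y)))\<^sup>2"
        unfolding f_def .
      also have "2 * (cmod (F p * q (Complex t y)))\<^sup>2 = ?c * (1 / (cmod (Complex t y - p'))\<^sup>2)"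
        using u by (simp add: q_def pp' norm_mult norm_divide power_mult_distrib power_divide)
      also have "(cmod (Complex t y - p'))\<^sup>2 = (t - Re p)\<^sup>2 + (y - e + u)\<^sup>2"
        by (simp add: cmod_power2 p'_def) (simp add: algebra_simps)
      also have "?c * (1 / ((t - Re p)\<^sup>2 + (y - e + u)\<^sup>2)) \<le> ?c * (1 / ((t - Re p)\<^sup>2 + u\<^sup>2))"
        using u y by (intro mult_left_mono divide_left_mono add_left_mono power_mono)
          (auto intro!: mult_pos_pos add_nonneg_pos)
      finally have "(cmod (f (Complex t y)))\<^sup>2 \<le> 2 * (cmod (F (Complex t y)))\<^sup>2 + ?c * (1 / ((t - Re p)\<^sup>2 + u\<^sup>2))"
        by simp
      then have "ennreal ((cmod (f (Complex t y)))\<^sup>2) \<le> ennreal (2 * (cmod (F (Complex t y)))\<^sup>2 + ?c * (1 / ((t - Re p)\<^sup>2 + u\<^sup>2)))"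
        by (rule ennreal_leI)
      also have "\<dots> = ennreal (2 * (cmod (F (Complex t y)))\<^sup>2) + ennreal (?c * (1 / ((t - Re p)\<^sup>2 + u\<^sup>2)))"
        by (rule ennreal_plus) auto
      also have "\<dots> = ennreal 2 * ennreal ((cmod (F (Complex t y)))\<^sup>2) + ennreal ?c * ennreal (1 / ((t - Re p)\<^sup>2 + u\<^sup>2))"
        by (subst (1 2) ennreal_mult) auto
      finally show "ennreal ((cmod (f (Complex t y)))\<^sup>2) \<le>
        ennreal 2 * ennreal ((cmod (F (Complex t y)))\<^sup>2) + ennreal ?c * ennreal (1 / ((t - Re p)\<^sup>2 + u\<^sup>2))" .
    qed
    also have "\<dots> = ennreal 2 * (\<integral>\<^sup>+t. ennreal ((cmod (F (Complex t y)))\<^sup>2) \<partial>lborel) +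
        ennreal ?c * (\<integral>\<^sup>+t. ennreal (1 / ((t - Re p)\<^sup>2 + u\<^sup>2)) \<partial>lborel)"
      by (subst nn_integral_add; (subst nn_integral_cmult)?; measurable) (simp add: nn_integral_cmult)
    also have "\<dots> \<le> ennreal 2 * ennreal (hardy_norm_sq_real F) + ennreal ?c * ennreal (pi / u)"
      by (intro add_mono mult_left_mono hardy_line_nn_integral_le[OF F y0])
        (simp_all add: poisson_kernel_nn_integral u)
    also have "\<dots> = ennreal (2 * hardy_norm_sq_real F) + ennreal (?c * (pi / u))"
      using u by (subst (1 2) ennreal_mult) (auto simp: hardy_norm_sq_real_nonneg)
    also have "\<dots> = ennreal M"
      using u by (subst ennreal_plus[symmetric]) (auto simp: hardy_norm_sq_real_nonneg M_def)
    finally show ?thesis .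
  qed
  note H0 = line_integral_quotient_eq_0[OF a holo eq M0 M]
  have H_line: "H (Complex t e) = F (Complex t e) / (Complex t e - p) -
      F p * (2 * \<i> * of_real u) * of_real (1 / ((t - Re p)\<^sup>2 + u\<^sup>2))" for t
  proof -
    have ne: "Complex t e \<noteq> p" "Complex t e \<noteq> p'" using u by (auto simp: p'_def u_def complex_eq_iff)
    have prod: "(Complex t e - p) * (Complex t e - p') = of_real ((t - Re p)\<^sup>2 + u\<^sup>2)"
      by (simp add: p'_def u_def complex_eq_iff power2_eq_square algebra_simps)
    have "H (Complex t e) = F (Complex t e) / (Complex t e - p) -
        F p * (p - p') * (1 / ((Complex t e - p) * (Complex t e - p')))"
    proof -
      have "H (Complex t e) = f (Complex t e) / (Complex t e - p)" using ne by (simp add: H_def fp)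
      then show ?thesis unfolding f_def q_def
        by (subst (asm) diff_divide_distrib) (simp add: mult.commute)
    qed
    then show ?thesis unfolding prod pp' by simp
  qed
  have P: "has_bochner_integral lborel (\<lambda>t. F p * (2 * \<i> * of_real u) * of_real (1 / ((t - Re p)\<^sup>2 + u\<^sup>2)))
      (F p * (2 * \<i> * of_real u) * of_real (pi / u))"
    by (intro has_bochner_integral_mult_right has_bochner_integral_of_real poisson_kernel_has_integral u)
  have val: "F p * (2 * \<i> * of_real u) * of_real (pi / u) = 2 * of_real pi * \<i> * F p"
    using u by (simp add: field_simps)
  have split: "F (Complex t e) / (Complex t e - p) = H (Complex t e) +
      F p * (2 * \<i> * of_real u) * of_real (1 / ((t - Re p)\<^sup>2 + u\<^sup>2))" for t
    by (simp add: H_line)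
  have "has_bochner_integral lborel (\<lambda>t. H (Complex t e)) 0"
    using H0 by (simp add: has_bochner_integral_iff)
  from has_bochner_integral_add[OF this P]
  have "has_bochner_integral lborel (\<lambda>t. F (Complex t e) / (Complex t e - p)) (2 * of_real pi * \<i> * F p)"
    unfolding split[symmetric] val by simp
  then show "integrable lborel (\<lambda>t. F (Complex t e) / (Complex t e - p))"
    "(LINT t|lborel. F (Complex t e) / (Complex t e - p)) = 2 * of_real pi * \<i> * F p"
    by (simp_all add: has_bochner_integral_iff)
qed

text \<open>
  The difference of the Cauchy integrals at \<open>p\<close> and at its reflection in the line.
\<close>

lemma line_poisson_formula:
  assumes F: "F \<in> hardy_space" and e: "0 < e" "e < Im p"
  defines "u \<equiv> Im p - e"
  shows "has_bochner_integral lborel (\<lambda>t. F (Complex t e) * of_real (u / pi / ((t - Re p)\<^sup>2 + u\<^sup>2))) (F p)"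
proof -
  have u: "0 < u" using e by (simp add: u_def)
  define p' where "p' = Complex (Re p) (e - u)"
  have "has_bochner_integral lborel (\<lambda>t. F (Complex t e) / (Complex t e - p)) (2 * of_real pi * \<i> * F p)"
    using line_cauchy_integral_above[OF F e] by (simp add: has_bochner_integral_iff)
  moreover have "has_bochner_integral lborel (\<lambda>t. F (Complex t e) / (Complex t e - p')) 0"
    using line_cauchy_integral_below[OF F e(1), of p'] u by (simp add: has_bochner_integral_iff p'_def)
  ultimately have "has_bochner_integral lborel
      (\<lambda>t. 1 / (2 * of_real pi * \<i>) * (F (Complex t e) / (Complex t e - p) - F (Complex t e) / (Complex t e - p')))
      (1 / (2 * of_real pi * \<i>) * (2 * of_real pi * \<i> * F p - 0))"
    by (intro has_bochner_integral_mult_right has_bochner_integral_diff)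
  moreover have "1 / (2 * of_real pi * \<i>) * (F (Complex t e) / (Complex t e - p) - F (Complex t e) / (Complex t e - p')) =
      F (Complex t e) * of_real (u / pi / ((t - Re p)\<^sup>2 + u\<^sup>2))" for t
  proof -
    have ne: "Complex t e - p \<noteq> 0" "Complex t e - p' \<noteq> 0" using u by (auto simp: p'_def u_def complex_eq_iff)
    have prod: "(Complex t e - p) * (Complex t e - p') = of_real ((t - Re p)\<^sup>2 + u\<^sup>2)"
      by (simp add: p'_def u_def complex_eq_iff power2_eq_square algebra_simps)
    have pp': "p - p' = 2 * \<i> * of_real u" by (simp add: p'_def u_def complex_eq_iff)
    have "F (Complex t e) / (Complex t e - p) - F (Complex t e) / (Complex t e - p') =
        F (Complex t e) * (p - p') / ((Complex t e - p) * (Complex t e - p'))"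
      using ne by (simp add: diff_frac_eq algebra_simps)
    then show ?thesis unfolding prod pp' by simp
  qed
  ultimately show ?thesis by simp
qed

text \<open>
  Jensen's inequality for the Poisson kernel. With \<open>l = |F p|\<close> the bound \<open>|F| \<le> l / 2 + |F|\<^sup>2 / (2 l)\<close> under the
  Poisson integral gives \<open>l \<le> l / 2 + Q / (2 l)\<close>, that is \<open>l\<^sup>2 \<le> Q\<close>.
\<close>

lemma hardy_norm_sq_le_poisson_integral:
  assumes F: "F \<in> hardy_space" and e: "0 < e" "e < Im p"
  defines "u \<equiv> Im p - e"
  shows "ennreal ((cmod (F p))\<^sup>2) \<le> (\<integral>\<^sup>+t. ennreal ((cmod (F (Complex t e)))\<^sup>2 * (u / pi / ((t - Re p)\<^sup>2 + u\<^sup>2))) \<partial>lborel)"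
proof (cases "F p = 0")
  case False
  define l where "l = cmod (F p)"
  have l: "0 < l" using False by (simp add: l_def)
  have u: "0 < u" using e by (simp add: u_def)
  define P where "P = (\<lambda>t. u / pi / ((t - Re p)\<^sup>2 + u\<^sup>2))"
  have P0: "0 \<le> P t" for t using u by (simp add: P_def)
  have P1: "has_bochner_integral lborel P 1"
    using has_bochner_integral_mult_right[OF poisson_kernel_has_integral[OF u, of "Re p"], of "u / pi"] u
    by (simp add: P_def)
  note [measurable] = hardy_line_measurable[OF F e(1)]
  have Q: "integrable lborel (\<lambda>t. (cmod (F (Complex t e)))\<^sup>2 * P t)"
  proof (rule Bochner_Integration.integrable_bound)
    show "integrable lborel (\<lambda>t. (1 / (u * pi)) * (cmod (F (Complex t e)))\<^sup>2)"
      using hardy_line_integrable[OF F e(1)] by simp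
    have "P t \<le> 1 / (u * pi)" for t
    proof -
      have "P t \<le> u / pi / u\<^sup>2" unfolding P_def
        using u by (intro divide_left_mono) (auto intro!: mult_pos_pos add_nonneg_pos)
      then show ?thesis using u by (simp add: power2_eq_square field_simps)
    qed
    then have "(cmod (F (Complex t e)))\<^sup>2 * P t \<le> (cmod (F (Complex t e)))\<^sup>2 * (1 / (u * pi))" for t
      by (rule mult_left_mono) simp
    then show "AE t in lborel. norm ((cmod (F (Complex t e)))\<^sup>2 * P t) \<le> norm ((1 / (u * pi)) * (cmod (F (Complex t e)))\<^sup>2)"
      using P0 u by (simp add: abs_mult)
  qed (simp add: P_def)
  have PF: "has_bochner_integral lborel (\<lambda>t. F (Complex t e) * of_real (P t)) (F p)"
    using line_poisson_formula[OF F e] by (simp add: P_def u_def)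
  have "l \<le> (LINT t|lborel. norm (F (Complex t e) * of_real (P t)))"
    unfolding l_def has_bochner_integral_integral_eq[OF PF, symmetric]
    by (rule integral_norm_bound)
  also have "\<dots> \<le> (LINT t|lborel. l / 2 * P t + 1 / (2 * l) * ((cmod (F (Complex t e)))\<^sup>2 * P t))"
  proof (rule integral_mono)
    show "integrable lborel (\<lambda>t. norm (F (Complex t e) * of_real (P t)))"
      using PF by (simp add: has_bochner_integral_iff)
    show "integrable lborel (\<lambda>t. l / 2 * P t + 1 / (2 * l) * ((cmod (F (Complex t e)))\<^sup>2 * P t))"
      using P1 Q by (auto simp: has_bochner_integral_iff)
    fix t
    have "2 * cmod (F (Complex t e)) * l \<le> (cmod (F (Complex t e)))\<^sup>2 + l\<^sup>2"
      by (rule sum_squares_bound)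
    then have "cmod (F (Complex t e)) \<le> l / 2 + 1 / (2 * l) * (cmod (F (Complex t e)))\<^sup>2"
      using l by (simp add: field_simps power2_eq_square)
    then have "cmod (F (Complex t e)) * P t \<le> (l / 2 + 1 / (2 * l) * (cmod (F (Complex t e)))\<^sup>2) * P t"
      by (intro mult_right_mono P0)
    then show "norm (F (Complex t e) * of_real (P t)) \<le> l / 2 * P t + 1 / (2 * l) * ((cmod (F (Complex t e)))\<^sup>2 * P t)"
      using P0[of t] by (simp add: norm_mult algebra_simps)
  qed
  also have "\<dots> = l / 2 + 1 / (2 * l) * (LINT t|lborel. (cmod (F (Complex t e)))\<^sup>2 * P t)"
    using P1 Q by (simp add: has_bochner_integral_iff)
  finally have "l\<^sup>2 \<le> (LINT t|lborel. (cmod (F (Complex t e)))\<^sup>2 * P t)"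
    using l by (simp add: field_simps power2_eq_square)
  also have "ennreal \<dots> = (\<integral>\<^sup>+t. ennreal ((cmod (F (Complex t e)))\<^sup>2 * P t) \<partial>lborel)"
    using Q P0 by (intro nn_integral_eq_integral[symmetric]) auto
  finally show ?thesis by (simp add: l_def P_def ennreal_leI)
qed simp

section \<open>Nontangential boundary values\<close>

text \<open>
  Seen from the real line, a point of the Stolz angle at \<open>x\<close> behaves like the point directly above
  \<open>x\<close>: the Poisson kernels of the two are comparable.
\<close>

lemma stolz_distance_le:
  assumes z: "z \<in> stolz_angle a x" and a: "0 < a"
  shows "(t - x)\<^sup>2 + (Im z)\<^sup>2 \<le> (2 * a\<^sup>2 + 2) * ((t - Re z)\<^sup>2 + (Im z)\<^sup>2)"
proof -
  have "\<bar>Re z - x\<bar> \<le> a * Im z" using z by (simp add: stolz_angle_def)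
  then have "\<bar>Re z - x\<bar>\<^sup>2 \<le> (a * Im z)\<^sup>2" by (intro power_mono) auto
  then have 1: "(Re z - x)\<^sup>2 \<le> a\<^sup>2 * (Im z)\<^sup>2" by (simp add: power_mult_distrib)
  have "(t - x)\<^sup>2 = ((t - Re z) + (Re z - x))\<^sup>2" by simp
  also have "\<dots> \<le> 2 * (t - Re z)\<^sup>2 + 2 * (Re z - x)\<^sup>2"
  proof -
    have "(A + B)\<^sup>2 \<le> 2 * A\<^sup>2 + 2 * B\<^sup>2" for A B :: real
      using sum_squares_bound[of A B] by (simp add: power2_sum)
    then show ?thesis .
  qed
  finally have "(t - x)\<^sup>2 + (Im z)\<^sup>2 \<le> 2 * (t - Re z)\<^sup>2 + (2 * a\<^sup>2 + 1) * (Im z)\<^sup>2"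
    using 1 by (simp add: algebra_simps)
  also have "\<dots> \<le> (2 * a\<^sup>2 + 2) * (t - Re z)\<^sup>2 + (2 * a\<^sup>2 + 2) * (Im z)\<^sup>2"
    by (intro add_mono mult_right_mono) auto
  finally show ?thesis by (simp add: distrib_left)
qed

text \<open>
  If \<open>|F| > l\<close> somewhere in the Stolz angle at \<open>x\<close>, the Poisson integral of \<open>|F|\<^sup>2\<close> over the line of height
  \<open>e\<close> exceeds a multiple of \<open>l\<^sup>2\<close>, so some ball around \<open>x\<close> has large mass and Vitali's lemma applies. The shift by \<open>e\<close> is there
  because the Poisson formula is available only on lines inside the half-plane.
\<close>

lemma nontangential_weak_type_shifted:
  assumes F: "F \<in> hardy_space" and e: "0 < e" and a: "0 < a" and l: "0 < l"
  shows "emeasure lborel {x. \<exists>z\<in>stolz_angle a x. l < cmod (F (z + \<i> * of_real e))} \<le>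
    ennreal (80 * ((2 * a\<^sup>2 + 2) / pi) / l\<^sup>2 * hardy_norm_sq_real F)" (is "emeasure lborel ?E \<le> _")
proof -
  note [measurable] = hardy_line_measurable[OF F e]
  define \<nu> where "\<nu> = density lborel (\<lambda>t. ennreal ((cmod (F (Complex t e)))\<^sup>2))"
  define c where "c = (2 * a\<^sup>2 + 2) / pi"
  have c: "0 < c" by (simp add: c_def add_nonneg_pos)
  \<comment> \<open>The threshold at which \<open>c * (8 * A) = l\<^sup>2\<close>, where 8 is the constant of the dyadic estimate.\<close>
  define A where "A = l\<^sup>2 / (8 * c)"
  have A: "0 < A" using c l by (simp add: A_def)
  have sets: "sets \<nu> = sets borel" by (simp add: \<nu>_def)
  have total: "emeasure \<nu> UNIV \<le> ennreal (hardy_norm_sq_real F)"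
    using hardy_line_nn_integral_le[OF F e] by (simp add: \<nu>_def emeasure_density)
  have large: "\<exists>r>0. ennreal (A * r) < emeasure \<nu> (cball x r)" if "x \<in> ?E" for x
  proof (rule ccontr)
    assume "\<not> ?thesis"
    then have small: "emeasure \<nu> (cball x r) \<le> ennreal (A * r)" if "0 < r" for r
      using that by (meson not_le)
    from \<open>x \<in> ?E\<close> obtain z where z: "z \<in> stolz_angle a x" and lz: "l < cmod (F (z + \<i> * of_real e))"
      by blast
    define u where "u = Im z"
    have u: "0 < u" using z by (simp add: u_def stolz_angle_def)
    have kernel: "u / pi / ((t - Re z)\<^sup>2 + u\<^sup>2) \<le> c * (u / ((t - x)\<^sup>2 + u\<^sup>2))" for t
    proof -
      have pos: "0 < (t - x)\<^sup>2 + u\<^sup>2" "0 < (t - Re z)\<^sup>2 + u\<^sup>2"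
        using u by (auto intro!: add_nonneg_pos)
      have "u / pi * ((t - x)\<^sup>2 + u\<^sup>2) \<le> u / pi * ((2 * a\<^sup>2 + 2) * ((t - Re z)\<^sup>2 + u\<^sup>2))"
        using stolz_distance_le[OF z a, of t] u unfolding u_def by (intro mult_left_mono) auto
      also have "\<dots> = c * u * ((t - Re z)\<^sup>2 + u\<^sup>2)" by (simp add: c_def)
      finally have *: "u / pi * ((t - x)\<^sup>2 + u\<^sup>2) \<le> c * u * ((t - Re z)\<^sup>2 + u\<^sup>2)" .
      have "u / pi / ((t - Re z)\<^sup>2 + u\<^sup>2) \<le> c * u / ((t - x)\<^sup>2 + u\<^sup>2)"
        using pos * by (simp only: pos_divide_le_eq pos_le_divide_eq times_divide_eq_left)
      then show ?thesis by simp
    qed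
    have "l\<^sup>2 < (cmod (F (z + \<i> * of_real e)))\<^sup>2"
      using l lz by (intro power_strict_mono) auto
    then have "ennreal (l\<^sup>2) < ennreal ((cmod (F (z + \<i> * of_real e)))\<^sup>2)"
      by (subst ennreal_less_iff) auto
    also have "\<dots> \<le> (\<integral>\<^sup>+t. ennreal ((cmod (F (Complex t e)))\<^sup>2 * (u / pi / ((t - Re z)\<^sup>2 + u\<^sup>2))) \<partial>lborel)"
      using hardy_norm_sq_le_poisson_integral[OF F e, of "z + \<i> * of_real e"] u by (simp add: u_def)
    also have "\<dots> = (\<integral>\<^sup>+t. ennreal (u / pi / ((t - Re z)\<^sup>2 + u\<^sup>2)) \<partial>\<nu>)"
      unfolding \<nu>_def using u by (subst nn_integral_density) (auto intro!: nn_integral_cong simp flip: ennreal_mult)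
    also have "\<dots> \<le> (\<integral>\<^sup>+t. ennreal c * ennreal (u / ((t - x)\<^sup>2 + u\<^sup>2)) \<partial>\<nu>)"
      using u c kernel by (intro nn_integral_mono) (auto simp flip: ennreal_mult intro!: ennreal_leI)
    also have "\<dots> = ennreal c * (\<integral>\<^sup>+t. ennreal (u / ((t - x)\<^sup>2 + u\<^sup>2)) \<partial>\<nu>)"
      by (rule nn_integral_cmult) (simp add: \<nu>_def)
    also have "\<dots> \<le> ennreal c * ennreal (8 * A)"
      using A u small sets by (intro mult_left_mono poisson_integral_le_of_averages) auto
    also have "\<dots> = ennreal (l\<^sup>2)"
      using c A by (simp flip: ennreal_mult) (simp add: A_def)
    finally show False by simp
  qed
  have "emeasure lborel ?E \<le> ennreal (10 / A) * emeasure \<nu> UNIV"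
    using total by (intro vitali_weak_type sets A large) (auto intro: le_less_trans)
  also have "\<dots> \<le> ennreal (10 / A) * ennreal (hardy_norm_sq_real F)"
    by (intro mult_left_mono total) auto
  also have "\<dots> = ennreal (10 / A * hardy_norm_sq_real F)"
    using A hardy_norm_sq_real_nonneg by (simp flip: ennreal_mult)
  also have "10 / A = 80 * c / l\<^sup>2" using c l by (simp add: A_def field_simps)
  finally show ?thesis by (simp add: c_def)
qed

lemma open_stolz_shadow: "open {x. \<exists>z\<in>stolz_angle a x. P z}"
proof -
  have "{x. \<exists>z\<in>stolz_angle a x. P z} = (\<Union>z\<in>{z. 0 < Im z \<and> P z}. {x. \<bar>Re z - x\<bar> < a * Im z})"
    by (auto simp: stolz_angle_def)
  moreover have "open {x::real. \<bar>Re z - x\<bar> < a * Im z}" for z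
    by (intro open_Collect_less continuous_intros)
  ultimately show ?thesis by auto
qed

lemma hardy_isCont:
  assumes "F \<in> hardy_space" "0 < Im z"
  shows "isCont F z"
  using hardy_continuous[OF assms(1)] open_upper_half_plane assms(2)
  by (auto simp: continuous_on_eq_continuous_at upper_half_plane_def)

text \<open>
  By continuity of \<open>F\<close>, a point of the exceptional set lies in the sets for all small enough shifts,
  so the bound for the shifted functions passes to the limit.
\<close>

lemma nontangential_weak_type:
  assumes F: "F \<in> hardy_space" and a: "0 < a" and l: "0 < l"
  shows "emeasure lborel {x. \<exists>z\<in>stolz_angle a x. l < cmod (F z)} \<le>
    ennreal (80 * ((2 * a\<^sup>2 + 2) / pi) / l\<^sup>2 * hardy_norm_sq_real F)" (is "emeasure lborel ?E \<le> ?C")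
proof -
  define E where "E = (\<lambda>k::nat. {x. \<exists>z\<in>stolz_angle a x. l < cmod (F (z + \<i> * of_real (1 / real (Suc k))))})"
  define D where "D = (\<lambda>N. \<Inter>k\<in>{N..}. E k)"
  have E: "emeasure lborel (E k) \<le> ?C" "E k \<in> sets lborel" for k
    unfolding E_def by (rule nontangential_weak_type_shifted[OF F _ a l]) (auto intro!: borel_open open_stolz_shadow)
  have D: "D N \<in> sets lborel" for N
    unfolding D_def using E(2) by (intro sets.countable_INT'') auto
  have "?E \<subseteq> (\<Union>N. D N)"
  proof
    fix x assume "x \<in> ?E"
    then obtain z where z: "z \<in> stolz_angle a x" "l < cmod (F z)" by blast
    then have "isCont F z" by (intro hardy_isCont[OF F]) (simp add: stolz_angle_def)
    moreover have "(\<lambda>k. z + \<i> * of_real (1 / real (Suc k))) \<longlonglongrightarrow> z + \<i> * of_real 0"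
      by (intro tendsto_intros LIMSEQ_Suc lim_1_over_n)
    ultimately have "(\<lambda>k. cmod (F (z + \<i> * of_real (1 / real (Suc k))))) \<longlonglongrightarrow> cmod (F z)"
      by (intro tendsto_norm isCont_tendsto_compose[of _ F]) auto
    from order_tendstoD(1)[OF this z(2)] obtain N
      where "\<And>k. N \<le> k \<Longrightarrow> l < cmod (F (z + \<i> * of_real (1 / real (Suc k))))"
      by (auto simp: eventually_sequentially)
    then have "x \<in> D N" using z(1) by (auto simp: D_def E_def)
    then show "x \<in> (\<Union>N. D N)" by blast
  qed
  then have "emeasure lborel ?E \<le> emeasure lborel (\<Union>N. D N)"
    using D by (intro emeasure_mono) auto
  also have "\<dots> = (SUP N. emeasure lborel (D N))"
    by (rule SUP_emeasure_incseq[symmetric]) (use D in \<open>auto simp: D_def incseq_def\<close>)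
  also have "\<dots> \<le> ?C"
  proof (rule SUP_least)
    fix N
    have "emeasure lborel (D N) \<le> emeasure lborel (E N)"
      using E(2) by (intro emeasure_mono) (auto simp: D_def)
    then show "emeasure lborel (D N) \<le> ?C" using E(1) by (rule order_trans)
  qed
  finally show ?thesis .
qed

lemma tendsto_Complex_at_right:
  assumes "0 < a"
  shows "filterlim (\<lambda>y. Complex x y) (at (complex_of_real x) within stolz_angle a x) (at_right 0)"
  unfolding filterlim_at
proof
  show "\<forall>\<^sub>F y in at_right 0. Complex x y \<in> stolz_angle a x \<and> Complex x y \<noteq> complex_of_real x"
    using eventually_at_right_less[of "0::real"]
    by (rule eventually_mono) (use assms in \<open>auto simp: stolz_angle_def complex_eq_iff\<close>)
  have "((\<lambda>y. Complex x y) \<longlongrightarrow> Complex x 0) (at_right 0)"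
    by (intro tendsto_intros)
  then show "((\<lambda>y. Complex x y) \<longlongrightarrow> complex_of_real x) (at_right 0)"
    by (simp add: complex_of_real_def)
qed

lemma nontangential_limit_vertical:
  assumes "has_nontangential_limit F x l"
  shows "((\<lambda>y. F (Complex x y)) \<longlongrightarrow> l) (at_right 0)"
proof (rule filterlim_compose[OF _ tendsto_Complex_at_right])
  show "(F \<longlongrightarrow> l) (at (complex_of_real x) within stolz_angle 1 x)"
    using assms by (simp add: has_nontangential_limit_def)
qed simp

lemma boundary_value_eqI:
  assumes "has_nontangential_limit F x l"
  shows "boundary_value F x = l"
  unfolding boundary_value_def
proof (rule the_equality)
  show "has_nontangential_limit F x l" by (rule assms)
next
  fix l' assume "has_nontangential_limit F x l'"
  then show "l' = l"
    using tendsto_unique[OF trivial_limit_at_right_real] nontangential_limit_vertical assms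
    by blast
qed

text \<open>
  The functions \<open>F (\<cdot> + i e j)\<close> are continuous at \<open>x\<close> and approximate \<open>F\<close> uniformly on ever wider Stolz
  angles, with errors tending to zero. Their values at \<open>x\<close> form a Cauchy sequence, and \<open>F\<close> tends to its limit.
\<close>

lemma nontangential_limitI:
  assumes F: "F \<in> hardy_space"
    and approx: "\<And>j::nat. \<exists>e>0. \<forall>z\<in>stolz_angle (real (Suc j)) x.
      cmod (F z - F (z + \<i> * of_real e)) \<le> 1 / real (Suc j)"
  shows "\<exists>l. has_nontangential_limit F x l"
proof -
  obtain e where e: "\<And>j. 0 < e j"
    and close: "\<And>j z. z \<in> stolz_angle (real (Suc j)) x \<Longrightarrow> cmod (F z - F (z + \<i> * of_real (e j))) \<le> 1 / real (Suc j)"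
    using approx by metis
  define c where "c = (\<lambda>j. F (of_real x + \<i> * of_real (e j)))"
  have lim: "((\<lambda>z. F (z + \<i> * of_real (e j))) \<longlongrightarrow> c j) (at (complex_of_real x) within S)" for j S
  proof -
    have "isCont F (of_real x + \<i> * of_real (e j))" using e by (intro hardy_isCont[OF F]) simp
    then show ?thesis unfolding c_def
      by (rule isCont_tendsto_compose) (intro tendsto_intros)
  qed
  have c_close: "cmod (c i - c j) \<le> 1 / real (Suc i) + 1 / real (Suc j)" for i j
  proof (rule tendsto_upperbound)
    show "((\<lambda>y. cmod (F (Complex x y + \<i> * of_real (e i)) - F (Complex x y + \<i> * of_real (e j)))) \<longlongrightarrow> cmod (c i - c j)) (at_right 0)"
      using filterlim_compose[OF lim tendsto_Complex_at_right[of 1 x]] by (intro tendsto_intros) auto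
    show "\<forall>\<^sub>F y in at_right 0. cmod (F (Complex x y + \<i> * of_real (e i)) - F (Complex x y + \<i> * of_real (e j))) \<le> 1 / real (Suc i) + 1 / real (Suc j)"
    proof (rule eventually_mono[OF eventually_at_right_less[of "0::real"]])
      fix y :: real assume "0 < y"
      then have "Complex x y \<in> stolz_angle (real (Suc k)) x" for k by (simp add: stolz_angle_def)
      note near = close[OF this[of i]] close[OF this[of j]]
      let ?A = "F (Complex x y)"
      let ?B = "F (Complex x y + \<i> * of_real (e i))" and ?C = "F (Complex x y + \<i> * of_real (e j))"
      have "?B - ?C = (?A - ?C) - (?A - ?B)" by simp
      then have "cmod (?B - ?C) \<le> cmod (?A - ?C) + cmod (?A - ?B)" by (metis norm_triangle_ineq4)
      then show "cmod (?B - ?C) \<le> 1 / real (Suc i) + 1 / real (Suc j)" using near by linarith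
    qed
  qed simp
  have inv0: "(\<lambda>i. 1 / real (Suc i)) \<longlonglongrightarrow> 0" by (intro LIMSEQ_Suc lim_1_over_n)
  have "Cauchy c"
  proof (rule metric_CauchyI)
    fix r :: real assume "0 < r"
    then obtain N where N: "1 / real (Suc N) < r / 2"
      using nat_approx_posE[of "r / 2"] by auto
    have "dist (c m) (c n) < r" if "N \<le> m" "N \<le> n" for m n
    proof -
      have "1 / real (Suc k) \<le> 1 / real (Suc N)" if "N \<le> k" for k
        using that by (simp add: field_simps)
      from this[OF that(1)] this[OF that(2)] show ?thesis
        using c_close[of m n] N by (simp add: dist_norm)
    qed
    then show "\<exists>M. \<forall>m\<ge>M. \<forall>n\<ge>M. dist (c m) (c n) < r" by blast
  qed
  then obtain l where l: "c \<longlonglongrightarrow> l" by (metis Cauchy_convergent convergent_def)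
  have c_l: "cmod (c j - l) \<le> 1 / real (Suc j)" for j
  proof (rule tendsto_le[OF _ _ tendsto_norm[OF tendsto_diff[OF tendsto_const l]]])
    show "(\<lambda>i. 1 / real (Suc j) + 1 / real (Suc i)) \<longlonglongrightarrow> 1 / real (Suc j)"
      using tendsto_add[OF tendsto_const inv0] by simp
  qed (use c_close in auto)
  have "has_nontangential_limit F x l"
    unfolding has_nontangential_limit_def
  proof (intro allI impI tendstoI)
    fix a r :: real assume "0 < a" "0 < r"
    obtain j1 where j1: "1 / real (Suc j1) < r / 3"
      using nat_approx_posE[of "r / 3"] \<open>0 < r\<close> by auto
    obtain j2 :: nat where j2: "a \<le> real j2" using real_arch_simple by blast
    define j where "j = max j1 j2"
    have "1 / real (Suc j) \<le> 1 / real (Suc j1)" by (simp add: j_def field_simps)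
    then have j: "1 / real (Suc j) < r / 3" using j1 by simp
    have sub: "stolz_angle a x \<subseteq> stolz_angle (real (Suc j)) x"
    proof -
      have "a \<le> real (Suc j)" using j2 by (simp add: j_def)
      then show ?thesis
        by (auto simp: stolz_angle_def intro: less_le_trans mult_right_mono)
    qed
    have "\<forall>\<^sub>F z in at (of_real x) within stolz_angle a x. dist (F (z + \<i> * of_real (e j))) (c j) < r / 3"
      using lim \<open>0 < r\<close> by (intro tendstoD) auto
    moreover have "\<forall>\<^sub>F z in at (complex_of_real x) within stolz_angle a x. z \<in> stolz_angle a x"
      by (simp add: eventually_at_filter)
    ultimately show "\<forall>\<^sub>F z in at (of_real x) within stolz_angle a x. dist (F z) l < r"
    proof eventually_elim
      case (elim z)
      have "dist (F z) l \<le> dist (F z) (F (z + \<i> * of_real (e j))) + dist (F (z + \<i> * of_real (e j))) (c j) + dist (c j) l"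
        using dist_triangle[of "F z" l "c j"] dist_triangle[of "F z" "c j" "F (z + \<i> * of_real (e j))"] by linarith
      also have "\<dots> < r"
        using elim(1) c_l[of j] close[of z j] sub elim(2) j by (auto simp: dist_norm)
      finally show ?case .
    qed
  qed
  then show ?thesis by blast
qed

lemma filterlim_inverse_Suc_at_right: "filterlim (\<lambda>k. 1 / real (Suc k)) (at_right 0) sequentially"
  unfolding filterlim_at using LIMSEQ_Suc[OF lim_1_over_n[where 'a = real]]
  by (auto intro!: always_eventually)

text \<open>
  Fatou's theorem for \<open>H\<^sup>2\<close>. The set where \<open>F - F (\<cdot> + i e)\<close> exceeds a fixed bound in the Stolz angle has
  measure at most a constant times the squared Hardy norm of that difference, which tends to zero with \<open>e\<close>.
\<close>

lemma AE_nontangential_limit: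
  assumes F: "F \<in> hardy_space"
  shows "AE x in lborel. has_nontangential_limit F x (boundary_value F x)"
proof -
  \<comment> \<open>One index \<open>j\<close> governs both the aperture and the tolerance: both conditions become stricter as \<open>j\<close> grows.\<close>
  define B where "B = (\<lambda>j k. {x. \<exists>z\<in>stolz_angle (real (Suc j)) x.
    1 / real (Suc j) < cmod (F z - F (z + \<i> * of_real (1 / real (Suc k))))})"
  define N where "N = (\<lambda>j. \<Inter>k::nat. B j k)"
  have B: "B j k \<in> sets lborel" for j k
    unfolding B_def using borel_open[OF open_stolz_shadow] by simp
  have N: "N j \<in> sets lborel" for j
    unfolding N_def using B by (intro sets.countable_INT) auto
  have null: "N j \<in> null_sets lborel" for j
  proof -
    define C where "C = 80 * ((2 * (real (Suc j))\<^sup>2 + 2) / pi) / (1 / real (Suc j))\<^sup>2"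
    have C: "0 \<le> C" by (simp add: C_def)
    define d where "d = (\<lambda>k. hardy_norm_sq_real F - line_norm_sq F (1 / real (Suc k)))"
    have "(\<lambda>k. line_norm_sq F (1 / real (Suc k))) \<longlonglongrightarrow> hardy_norm_sq_real F"
      by (rule filterlim_compose[OF line_norm_sq_tendsto[OF F] filterlim_inverse_Suc_at_right])
    then have "d \<longlonglongrightarrow> hardy_norm_sq_real F - hardy_norm_sq_real F"
      unfolding d_def by (intro tendsto_intros)
    then have "(\<lambda>k. C * d k) \<longlonglongrightarrow> 0"
      by (intro tendsto_mult_right_zero) simp
    then have lim: "(\<lambda>k. ennreal (C * d k)) \<longlonglongrightarrow> ennreal 0" by (rule tendsto_ennrealI)
    have "emeasure lborel (N j) \<le> ennreal (C * d k)" for k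
    proof -
      have "emeasure lborel (N j) \<le> emeasure lborel (B j k)"
        using B by (intro emeasure_mono) (auto simp: N_def)
      also have "\<dots> \<le> ennreal (C * hardy_norm_sq_real (\<lambda>z. F z - F (z + \<i> * of_real (1 / real (Suc k)))))"
        unfolding B_def C_def by (rule nontangential_weak_type[OF hardy_vertical_difference(1)[OF F]]) auto
      also have "\<dots> \<le> ennreal (C * d k)"
        unfolding d_def by (intro ennreal_leI mult_left_mono C hardy_vertical_difference(2)[OF F]) auto
      finally show ?thesis .
    qed
    then have "emeasure lborel (N j) \<le> ennreal 0"
      by (intro LIMSEQ_le_const[OF lim]) auto
    then show ?thesis using N by (simp add: null_setsI)
  qed
  then have "(\<Union>j. N j) \<in> null_sets lborel" by (intro null_sets_UN) auto
  then show ?thesis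
  proof (rule AE_I'[OF _ subsetI])
    fix x assume "x \<in> {x \<in> space lborel. \<not> has_nontangential_limit F x (boundary_value F x)}"
    then have no: "\<not> (\<exists>l. has_nontangential_limit F x l)" using boundary_value_eqI by auto
    show "x \<in> (\<Union>j. N j)"
    proof (rule ccontr)
      assume x: "x \<notin> (\<Union>j. N j)"
      have "\<exists>l. has_nontangential_limit F x l"
      proof (rule nontangential_limitI[OF F])
        fix j
        from x obtain k where "x \<notin> B j k" by (auto simp: N_def)
        then have "\<forall>z\<in>stolz_angle (real (Suc j)) x. cmod (F z - F (z + \<i> * of_real (1 / real (Suc k)))) \<le> 1 / real (Suc j)"
          by (auto simp: B_def not_less)
        then show "\<exists>e>0. \<forall>z\<in>stolz_angle (real (Suc j)) x. cmod (F z - F (z + \<i> * of_real e)) \<le> 1 / real (Suc j)"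
          by (intro exI[of _ "1 / real (Suc k)"]) simp
      qed
      then show False using no by blast
    qed
  qed
qed

section \<open>Mean-square convergence to the boundary values\<close>

lemma AE_vertical_limit:
  assumes F: "F \<in> hardy_space"
  shows "AE x in lborel. ((\<lambda>y. F (Complex x y)) \<longlongrightarrow> boundary_value F x) (at_right 0)"
  using AE_nontangential_limit[OF F] by eventually_elim (rule nontangential_limit_vertical)

lemma boundary_value_measurable:
  assumes F: "F \<in> hardy_space"
  shows "boundary_value F \<in> borel_measurable lebesgue"
proof (rule borel_measurable_AE)
  have "(\<lambda>x. lim (\<lambda>k. F (Complex x (1 / real (Suc k))))) \<in> borel_measurable lborel"
    using hardy_line_measurable[OF F] by (intro borel_measurable_lim_metric) simp
  then show "(\<lambda>x. lim (\<lambda>k. F (Complex x (1 / real (Suc k))))) \<in> borel_measurable lebesgue"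
    by (rule measurable_completion)
  have "AE x in lborel. lim (\<lambda>k. F (Complex x (1 / real (Suc k)))) = boundary_value F x"
    using AE_vertical_limit[OF F]
    by eventually_elim (intro limI filterlim_compose[OF _ filterlim_inverse_Suc_at_right])
  then show "AE x in lebesgue. lim (\<lambda>k. F (Complex x (1 / real (Suc k)))) = boundary_value F x"
    by (rule AE_completion)
qed

lemma hardy_line_measurable_lebesgue:
  assumes "F \<in> hardy_space" "0 < y"
  shows "(\<lambda>x. F (Complex x y)) \<in> borel_measurable lebesgue"
  using hardy_line_measurable[OF assms] by (intro measurable_completion) simp

text \<open>
  Fatou's lemma for the limit \<open>y \<rightarrow> 0\<close> in the distance formula for the lines \<open>e\<close> and \<open>y\<close>.
\<close>

lemma boundary_distance_sq_le:
  assumes F: "F \<in> hardy_space" and e: "0 < e"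
  shows "(\<integral>\<^sup>+x. ennreal ((cmod (F (Complex x e) - boundary_value F x))\<^sup>2) \<partial>lebesgue) \<le>
    ennreal (hardy_norm_sq_real F - line_norm_sq F e)"
proof -
  define G where "G = (\<lambda>k x. ennreal ((cmod (F (Complex x e) - F (Complex x (1 / real (Suc k)))))\<^sup>2))"
  have [measurable]: "G k \<in> borel_measurable borel" for k
    unfolding G_def using hardy_line_measurable[OF F e] hardy_line_measurable[OF F, of "1 / real (Suc k)"]
    by simp
  have "AE x in lborel. ennreal ((cmod (F (Complex x e) - boundary_value F x))\<^sup>2) = liminf (\<lambda>k. G k x)"
    using AE_vertical_limit[OF F]
  proof eventually_elim
    case (elim x)
    have "(\<lambda>k. F (Complex x (1 / real (Suc k)))) \<longlonglongrightarrow> boundary_value F x"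
      by (rule filterlim_compose[OF elim filterlim_inverse_Suc_at_right])
    then have "(\<lambda>k. G k x) \<longlonglongrightarrow> ennreal ((cmod (F (Complex x e) - boundary_value F x))\<^sup>2)"
      unfolding G_def by (intro tendsto_ennrealI tendsto_intros)
    then show ?case by (intro lim_imp_Liminf[symmetric]) auto
  qed
  then have "AE x in lebesgue. ennreal ((cmod (F (Complex x e) - boundary_value F x))\<^sup>2) = liminf (\<lambda>k. G k x)"
    by (rule AE_completion)
  then have "(\<integral>\<^sup>+x. ennreal ((cmod (F (Complex x e) - boundary_value F x))\<^sup>2) \<partial>lebesgue) =
      (\<integral>\<^sup>+x. liminf (\<lambda>k. G k x) \<partial>lebesgue)"
    by (rule nn_integral_cong_AE)
  also have "\<dots> = (\<integral>\<^sup>+x. liminf (\<lambda>k. G k x) \<partial>lborel)"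
    by (rule nn_integral_completion)
  also have "\<dots> \<le> liminf (\<lambda>k. \<integral>\<^sup>+x. G k x \<partial>lborel)"
    by (rule nn_integral_liminf) simp
  also have "\<dots> \<le> ennreal (hardy_norm_sq_real F - line_norm_sq F e)"
  proof (rule Liminf_le)
    obtain K where K: "1 / real (Suc K) < e" using nat_approx_posE[OF e] by blast
    show "\<forall>\<^sub>F k in sequentially. (\<integral>\<^sup>+x. G k x \<partial>lborel) \<le> ennreal (hardy_norm_sq_real F - line_norm_sq F e)"
      using eventually_ge_at_top[of K]
    proof eventually_elim
      case (elim k)
      define y where "y = 1 / real (Suc k)"
      have "1 / real (Suc k) \<le> 1 / real (Suc K)" using elim by (simp add: field_simps)
      then have y: "0 < y" "y \<le> e" using K by (simp_all add: y_def)
      have "(\<integral>\<^sup>+x. G k x \<partial>lborel) = ennreal (LINT x|lborel. (cmod (F (Complex x e) - F (Complex x y)))\<^sup>2)"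
        unfolding G_def y_def[symmetric]
        by (rule nn_integral_eq_integral[OF line_distance_sq_eq(1)[OF F e y(1)]]) simp
      also have "(LINT x|lborel. (cmod (F (Complex x e) - F (Complex x y)))\<^sup>2) \<le> hardy_norm_sq_real F - line_norm_sq F e"
      proof -
        have "line_norm_sq F e \<le> line_norm_sq F ((e + y) / 2)"
          using y by (intro line_norm_sq_antimono[OF F]) auto
        then show ?thesis
          unfolding line_distance_sq_eq(2)[OF F e y(1)]
          using line_norm_sq_le_hardy_norm_sq_real[OF F y(1)] by simp
      qed
      finally show ?case by (simp add: ennreal_leI)
    qed
  qed simp
  finally show ?thesis .
qed

text \<open>
  The error is at most \<open>d e / s + s * \<kappa>\<close>, where \<open>d e\<close> bounds the squared \<open>L\<^sup>2\<close> distance between \<open>F\<close> on the line of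
  height \<open>e\<close> and its boundary values and \<open>\<kappa>\<close> is the squared norm of \<open>k\<close>: fix a small \<open>s\<close> first, then let \<open>e\<close> tend to zero.
\<close>

lemma boundary_inner_product_limit:
  assumes F: "F \<in> hardy_space" and k_meas: "k \<in> borel_measurable borel"
    and k: "integrable lborel (\<lambda>x. (cmod (k x))\<^sup>2)"
  shows "((\<lambda>e. LINT x|lborel. F (Complex x e) * cnj (k x)) \<longlongrightarrow>
    (LINT x|lebesgue. boundary_value F x * cnj (k x))) (at_right 0)"
proof -
  have kl_meas: "k \<in> borel_measurable lebesgue"
    using k_meas by (intro measurable_completion) simp
  have kl: "integrable lebesgue (\<lambda>x. (cmod (k x))\<^sup>2)"
    using k k_meas by (subst integrable_completion) auto
  define \<kappa> where "\<kappa> = (LINT x|lebesgue. (cmod (k x))\<^sup>2)"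
  have \<kappa>: "0 \<le> \<kappa>" by (simp add: \<kappa>_def)
  define d where "d = (\<lambda>e. hardy_norm_sq_real F - line_norm_sq F e)"
  let ?I = "LINT x|lebesgue. boundary_value F x * cnj (k x)"
  let ?J = "\<lambda>e. LINT x|lborel. F (Complex x e) * cnj (k x)"
  have dist_le: "cmod (?J e - ?I) \<le> d e / s + s * \<kappa>" if e: "0 < e" and s: "0 < s" for e s
  proof -
    define D where "D = (\<lambda>x. F (Complex x e) - boundary_value F x)"
    have D_meas: "D \<in> borel_measurable lebesgue"
      unfolding D_def by (intro borel_measurable_diff hardy_line_measurable_lebesgue[OF F e] boundary_value_measurable[OF F])
    have D_le: "(\<integral>\<^sup>+x. ennreal ((cmod (D x))\<^sup>2) \<partial>lebesgue) \<le> ennreal (d e)"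
      unfolding D_def d_def by (rule boundary_distance_sq_le[OF F e])
    then have D_int: "integrable lebesgue (\<lambda>x. (cmod (D x))\<^sup>2)"
      using D_meas le_less_trans[OF D_le] by (simp add: integrable_iff_bounded)
    have "ennreal (LINT x|lebesgue. (cmod (D x))\<^sup>2) \<le> ennreal (d e)"
      using D_le nn_integral_eq_integral[OF D_int] by simp
    then have D_val: "(LINT x|lebesgue. (cmod (D x))\<^sup>2) \<le> d e"
      using line_norm_sq_le_hardy_norm_sq_real[OF F e] by (simp add: d_def)
    have int_Dk: "integrable lebesgue (\<lambda>x. D x * cnj (k x))"
      by (rule integrable_mult_cnj[OF D_meas kl_meas D_int kl])
    have int_Fk: "integrable lborel (\<lambda>x. F (Complex x e) * cnj (k x))"
      using hardy_line_measurable[OF F e] k_meas hardy_line_integrable[OF F e] k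
      by (intro integrable_mult_cnj) auto
    have int_Fkl: "integrable lebesgue (\<lambda>x. F (Complex x e) * cnj (k x))"
      using int_Fk by (subst integrable_completion) auto
    have J: "?J e = (LINT x|lebesgue. F (Complex x e) * cnj (k x))"
      using int_Fk by (intro integral_completion[symmetric]) auto
    have "?I = (LINT x|lebesgue. F (Complex x e) * cnj (k x) - D x * cnj (k x))"
      by (simp add: D_def algebra_simps)
    also have "\<dots> = ?J e - (LINT x|lebesgue. D x * cnj (k x))"
      unfolding J by (rule Bochner_Integration.integral_diff[OF int_Fkl int_Dk])
    finally have "cmod (?J e - ?I) = cmod (LINT x|lebesgue. D x * cnj (k x))" by simp
    also have "\<dots> \<le> (LINT x|lebesgue. cmod (D x * cnj (k x)))" by (rule integral_norm_bound)
    also have "\<dots> \<le> (LINT x|lebesgue. (cmod (D x))\<^sup>2 / s + s * (cmod (k x))\<^sup>2)"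
    proof (rule integral_mono)
      show "integrable lebesgue (\<lambda>x. cmod (D x * cnj (k x)))" using int_Dk by simp
      show "integrable lebesgue (\<lambda>x. (cmod (D x))\<^sup>2 / s + s * (cmod (k x))\<^sup>2)" using D_int kl by simp
      show "cmod (D x * cnj (k x)) \<le> (cmod (D x))\<^sup>2 / s + s * (cmod (k x))\<^sup>2" for x
        using cmod_mult_le_sum_squares[OF s, of "D x" "cnj (k x)"] by simp
    qed
    also have "\<dots> = (LINT x|lebesgue. (cmod (D x))\<^sup>2) / s + s * \<kappa>"
      using D_int kl by (simp add: \<kappa>_def)
    also have "\<dots> \<le> d e / s + s * \<kappa>" using D_val s by (simp add: divide_right_mono)
    finally show ?thesis .
  qed
  show ?thesis
  proof (rule tendstoI)
    fix r :: real assume r: "0 < r"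
    define s where "s = r / (2 * (\<kappa> + 1))"
    have s: "0 < s" using r \<kappa> by (simp add: s_def)
    have "s * \<kappa> < s * (\<kappa> + 1)" using s by simp
    also have "s * (\<kappa> + 1) = r / 2" using \<kappa> by (simp add: s_def field_simps)
    finally have sk: "s * \<kappa> < r / 2" .
    have "(d \<longlongrightarrow> hardy_norm_sq_real F - hardy_norm_sq_real F) (at_right 0)"
      unfolding d_def by (intro tendsto_intros line_norm_sq_tendsto F)
    then have "\<forall>\<^sub>F e in at_right 0. d e < s * r / 2"
      by (rule order_tendstoD) (use s r in simp)
    then show "\<forall>\<^sub>F e in at_right 0. dist (?J e) ?I < r"
      using eventually_at_right_less[of "0::real"]
    proof eventually_elim
      case (elim e)
      have "d e / s < r / 2" using elim(1) s by (simp add: field_simps)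
      then show ?case using dist_le[OF elim(2) s] sk unfolding dist_norm by linarith
    qed
  qed
qed

section \<open>Laplace transforms of functions of subexponential growth\<close>

text \<open>
  The class is closed under sums and products and contains all polynomials and all bounded
  functions, and its continuous members have Laplace transforms on the whole open half-plane.
\<close>

definition subexponential :: "(real \<Rightarrow> real) \<Rightarrow> bool" where
  "subexponential f \<longleftrightarrow> (\<forall>d>0. \<exists>C. \<forall>x\<ge>0. \<bar>f x\<bar> \<le> C * exp (d * x))"

lemma subexponential_bounded:
  assumes "\<And>x. 0 \<le> x \<Longrightarrow> \<bar>f x\<bar> \<le> C"
  shows "subexponential f"
  unfolding subexponential_def
proof (intro allI impI exI[of _ "C"])
  fix d x :: real assume d: "0 < d" "0 \<le> x"
  have "0 \<le> C" using assms[OF d(2)] by simp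
  then have "C * 1 \<le> C * exp (d * x)" using d by (intro mult_left_mono) auto
  then show "\<bar>f x\<bar> \<le> C * exp (d * x)" using assms[OF d(2)] by simp
qed

lemma subexponential_const: "subexponential (\<lambda>_. c)"
  by (rule subexponential_bounded[of _ "\<bar>c\<bar>"]) simp

lemma subexponential_ident: "subexponential (\<lambda>x. x)"
  unfolding subexponential_def
proof (intro allI impI)
  fix d :: real assume d: "0 < d"
  have "\<bar>x\<bar> \<le> 1 / d * exp (d * x)" if "0 \<le> x" for x
  proof -
    have "d * x \<le> exp (d * x)" using exp_ge_add_one_self[of "d * x"] by linarith
    then show ?thesis using d that by (simp add: field_simps)
  qed
  then show "\<exists>C. \<forall>x\<ge>0. \<bar>x\<bar> \<le> C * exp (d * x)" by blast
qed

lemma subexponential_add: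
  assumes "subexponential f" "subexponential g"
  shows "subexponential (\<lambda>x. f x + g x)"
  unfolding subexponential_def
proof (intro allI impI)
  fix d :: real assume d: "0 < d"
  obtain A B where A: "\<And>x. 0 \<le> x \<Longrightarrow> \<bar>f x\<bar> \<le> A * exp (d * x)" and B: "\<And>x. 0 \<le> x \<Longrightarrow> \<bar>g x\<bar> \<le> B * exp (d * x)"
    using assms d unfolding subexponential_def by meson
  have "\<bar>f x + g x\<bar> \<le> (A + B) * exp (d * x)" if "0 \<le> x" for x
    using A[OF that] B[OF that] abs_triangle_ineq[of "f x" "g x"] unfolding distrib_right by linarith
  then show "\<exists>C. \<forall>x\<ge>0. \<bar>f x + g x\<bar> \<le> C * exp (d * x)" by blast
qed

lemma subexponential_mult:
  assumes "subexponential f" "subexponential g"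
  shows "subexponential (\<lambda>x. f x * g x)"
  unfolding subexponential_def
proof (intro allI impI)
  fix d :: real assume d: "0 < d"
  then have "0 < d / 2" by simp
  then obtain A B where A: "\<And>x. 0 \<le> x \<Longrightarrow> \<bar>f x\<bar> \<le> A * exp (d / 2 * x)" and B: "\<And>x. 0 \<le> x \<Longrightarrow> \<bar>g x\<bar> \<le> B * exp (d / 2 * x)"
    using assms unfolding subexponential_def by meson
  have "\<bar>f x * g x\<bar> \<le> (A * B) * exp (d * x)" if "0 \<le> x" for x
  proof -
    have "\<bar>f x * g x\<bar> \<le> (A * exp (d / 2 * x)) * (B * exp (d / 2 * x))"
      unfolding abs_mult using A[OF that] B[OF that]
      by (intro mult_mono) (auto intro: order_trans[OF abs_ge_zero])
    also have "\<dots> = (A * B) * (exp (d / 2 * x) * exp (d / 2 * x))" by simp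
    also have "exp (d / 2 * x) * exp (d / 2 * x) = exp (d * x)" by (simp flip: exp_add)
    finally show ?thesis .
  qed
  then show "\<exists>C. \<forall>x\<ge>0. \<bar>f x * g x\<bar> \<le> C * exp (d * x)" by blast
qed

lemma subexponential_power:
  assumes "subexponential f"
  shows "subexponential (\<lambda>x. f x ^ m)"
  by (induction m) (auto intro: subexponential_const subexponential_mult assms)

lemma subexponential_sum:
  assumes "\<And>i. i \<in> I \<Longrightarrow> subexponential (f i)"
  shows "subexponential (\<lambda>x. \<Sum>i\<in>I. f i x)"
  using assms
  by (induction I rule: infinite_finite_induct) (auto intro: subexponential_const subexponential_add)

lemmas subexponential_intros =
  subexponential_const subexponential_ident subexponential_add subexponential_mult
  subexponential_power subexponential_sum

lemma integrable_exp_decay: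
  fixes d :: real assumes d: "0 < d"
  shows "integrable lborel (\<lambda>x. indicator {0..} x * exp (- d * x))"
proof -
  have "((\<lambda>x. exp (- d * x)) \<longlongrightarrow> 0) at_top" using d by real_asymp
  then have lim: "((\<lambda>x. - exp (- d * x) / d) \<longlongrightarrow> 0) at_top"
    using tendsto_mult_right_zero[of "\<lambda>x. exp (- d * x)" at_top "- 1 / d"] by simp
  have "(\<integral>\<^sup>+x. ennreal (exp (- d * x)) * indicator {0..} x \<partial>lborel) = ennreal (0 - (- exp (- d * 0) / d))"
    by (rule nn_integral_FTC_atLeast[OF _ _ _ lim]) (use d in \<open>auto intro!: derivative_eq_intros\<close>)
  moreover have "(\<integral>\<^sup>+x. ennreal (norm (indicator {0..} x * exp (- d * x))) \<partial>lborel) =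
      (\<integral>\<^sup>+x. ennreal (exp (- d * x)) * indicator {0..} x \<partial>lborel)"
    by (intro nn_integral_cong) (auto split: split_indicator)
  ultimately show ?thesis by (simp add: integrable_iff_bounded)
qed

text \<open>
  The exponent is \<open>+ x \<zeta>\<close>, so the transform lives on \<open>Re \<zeta> < 0\<close> and its derivative is the transform of
  \<open>x * f x\<close> without a sign.
\<close>

definition laplace_transform :: "(real \<Rightarrow> real) \<Rightarrow> complex \<Rightarrow> complex" where
  "laplace_transform f \<zeta> = (LINT x:{0..}|lborel. of_real (f x) * exp (of_real x * \<zeta>))"

lemma integrable_laplace_norm:
  assumes f: "subexponential f" "continuous_on UNIV f" and s: "s < 0"
  shows "integrable lborel (\<lambda>x. indicator {0..} x * (\<bar>f x\<bar> * exp (s * x)))"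
proof -
  have [measurable]: "f \<in> borel_measurable borel" by (rule borel_measurable_continuous_onI[OF f(2)])
  have "0 < - s / 2" using s by simp
  then obtain C where C: "\<And>x. 0 \<le> x \<Longrightarrow> \<bar>f x\<bar> \<le> C * exp (- s / 2 * x)"
    using f(1) unfolding subexponential_def by meson
  show ?thesis
  proof (rule Bochner_Integration.integrable_bound)
    show "integrable lborel (\<lambda>x. C * (indicator {0..} x * exp (- (- s / 2) * x)))"
      by (intro integrable_mult_right integrable_exp_decay) (use s in simp)
    show "AE x in lborel. norm (indicator {0..} x * (\<bar>f x\<bar> * exp (s * x))) \<le> norm (C * (indicator {0..} x * exp (- (- s / 2) * x)))"
    proof (rule AE_I2)
      fix x
      show "norm (indicator {0..} x * (\<bar>f x\<bar> * exp (s * x))) \<le> norm (C * (indicator {0..} x * exp (- (- s / 2) * x)))"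
      proof (cases "0 \<le> x")
        case True
        have "\<bar>f x\<bar> * exp (s * x) \<le> C * exp (- s / 2 * x) * exp (s * x)"
          by (intro mult_right_mono C True) simp
        also have "\<dots> = C * exp (- (- s / 2) * x)" by (simp add: mult.assoc flip: exp_add)
        also have "\<dots> \<le> \<bar>C * exp (- (- s / 2) * x)\<bar>" by simp
        finally show ?thesis using True by (simp add: abs_mult)
      qed simp
    qed
  qed simp
qed

lemma integrable_laplace:
  assumes f: "subexponential f" "continuous_on UNIV f" and s: "Re \<zeta> < 0"
  shows "set_integrable lborel {0..} (\<lambda>x. of_real (f x) * exp (of_real x * \<zeta>))"
  unfolding set_integrable_def
proof (rule Bochner_Integration.integrable_bound[OF integrable_laplace_norm[OF f s]])
  have "continuous_on UNIV (\<lambda>x. of_real (f x) * exp (of_real x * \<zeta>) :: complex)"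
    by (intro continuous_intros f)
  then show "(\<lambda>x. indicator {0..} x *\<^sub>R (of_real (f x) * exp (of_real x * \<zeta>))) \<in> borel_measurable lborel"
    using borel_measurable_continuous_onI by (intro borel_measurable_scaleR) auto
  show "AE x in lborel. norm (indicator {0..} x *\<^sub>R (of_real (f x) * exp (of_real x * \<zeta>)))
      \<le> norm (indicator {0..} x * (\<bar>f x\<bar> * exp (Re \<zeta> * x)))"
    by (rule AE_I2) (simp add: norm_mult abs_mult mult.commute)
qed

lemma laplace_transform_sum:
  assumes "\<And>i. i \<in> I \<Longrightarrow> subexponential (f i)" "\<And>i. i \<in> I \<Longrightarrow> continuous_on UNIV (f i)" "Re \<zeta> < 0"
  shows "laplace_transform (\<lambda>x. \<Sum>i\<in>I. f i x) \<zeta> = (\<Sum>i\<in>I. laplace_transform (f i) \<zeta>)"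
proof -
  have "laplace_transform (\<lambda>x. \<Sum>i\<in>I. f i x) \<zeta> =
      (LINT x|lborel. (\<Sum>i\<in>I. indicator {0..} x *\<^sub>R (of_real (f i x) * exp (of_real x * \<zeta>))))"
    by (simp add: laplace_transform_def set_lebesgue_integral_def sum_distrib_right scaleR_sum_right)
  also have "\<dots> = (\<Sum>i\<in>I. laplace_transform (f i) \<zeta>)"
    unfolding laplace_transform_def set_lebesgue_integral_def
    using integrable_laplace[OF assms(1,2,3)]
    by (intro Bochner_Integration.integral_sum) (simp add: set_integrable_def)
  finally show ?thesis .
qed

text \<open>
  Taylor's estimate \<open>|exp u - 1 - u| \<le> exp |Re u| * |u|\<^sup>2\<close> with \<open>u = x h\<close> bounds the error of the difference
  quotient by \<open>|h|\<close> times an integral that converges when \<open>|h|\<close> is less than half the distance from \<open>\<zeta>\<close> to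
  the imaginary axis.
\<close>

lemma laplace_transform_deriv:
  assumes f: "subexponential f" "continuous_on UNIV f" and s: "Re \<zeta> < 0"
  shows "(laplace_transform f has_field_derivative laplace_transform (\<lambda>x. x * f x) \<zeta>) (at \<zeta>)"
proof -
  \<comment> \<open>Half the distance to the imaginary axis leaves room for the factor \<open>exp (\<delta> * x)\<close> in the estimate.\<close>
  define \<delta> where "\<delta> = - Re \<zeta> / 2"
  have \<delta>: "0 < \<delta>" using s by (simp add: \<delta>_def)
  have xf: "subexponential (\<lambda>x. x * f x)" "continuous_on UNIV (\<lambda>x. x * f x)"
    by (intro subexponential_intros f continuous_intros)+
  have xxf: "subexponential (\<lambda>x. x * (x * f x))" "continuous_on UNIV (\<lambda>x. x * (x * f x))"
    by (intro subexponential_intros f continuous_intros)+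
  define B where "B = (\<lambda>x. indicator {0..} x * (\<bar>x * (x * f x)\<bar> * exp ((Re \<zeta> + \<delta>) * x)))"
  have B: "integrable lborel B" unfolding B_def
    by (rule integrable_laplace_norm[OF xxf]) (use s in \<open>simp add: \<delta>_def\<close>)
  let ?q = "\<lambda>h. (laplace_transform f (\<zeta> + h) - laplace_transform f \<zeta>) / h"
  let ?D = "laplace_transform (\<lambda>x. x * f x) \<zeta>"
  have est: "cmod (?q h - ?D) \<le> cmod h * (LINT x|lborel. B x)" if h: "h \<noteq> 0" "cmod h < \<delta>" for h
  proof -
    have Re_h: "\<bar>Re h\<bar> \<le> cmod h" by (rule abs_Re_le_cmod)
    then have sh: "Re (\<zeta> + h) < 0" using h s by (simp add: \<delta>_def)
    define R where "R = (\<lambda>x. indicator {0..} x *\<^sub>R (of_real (f x) * exp (of_real x * \<zeta>) * (exp (of_real x * h) - 1 - of_real x * h)))"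
    define i1 where "i1 = (\<lambda>x::real. indicator {0..} x *\<^sub>R (of_real (f x) * exp (of_real x * (\<zeta> + h))))"
    define i2 where "i2 = (\<lambda>x::real. indicator {0..} x *\<^sub>R (of_real (f x) * exp (of_real x * \<zeta>)))"
    define i3 where "i3 = (\<lambda>x::real. indicator {0..} x *\<^sub>R (of_real (x * f x) * exp (of_real x * \<zeta>)))"
    have i: "integrable lborel i1" "integrable lborel i2" "integrable lborel i3"
      using integrable_laplace[OF f sh] integrable_laplace[OF f s] integrable_laplace[OF xf s]
      by (simp_all add: set_integrable_def i1_def i2_def i3_def)
    have R_eq: "R = (\<lambda>x. i1 x - i2 x - h * i3 x)"
      by (auto simp: fun_eq_iff R_def i1_def i2_def i3_def algebra_simps exp_add split: split_indicator)
    have R_int: "integrable lborel R" unfolding R_eq using i by simp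
    have "(LINT x|lborel. R x) = (LINT x|lborel. i1 x) - (LINT x|lborel. i2 x) - h * (LINT x|lborel. i3 x)"
      unfolding R_eq using i by simp
    also have "\<dots> = h * (?q h - ?D)"
    proof -
      have "laplace_transform f (\<zeta> + h) = (LINT x|lborel. i1 x)" "laplace_transform f \<zeta> = (LINT x|lborel. i2 x)"
        "?D = (LINT x|lborel. i3 x)"
        by (simp_all add: laplace_transform_def set_lebesgue_integral_def i1_def i2_def i3_def)
      then show ?thesis using h by (simp add: right_diff_distrib diff_divide_distrib)
    qed
    finally have "cmod h * cmod (?q h - ?D) = cmod (LINT x|lborel. R x)"
      by (simp add: norm_mult)
    also have "\<dots> \<le> (LINT x|lborel. cmod (R x))" by (rule integral_norm_bound)
    also have "\<dots> \<le> (LINT x|lborel. (cmod h)\<^sup>2 * B x)"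
    proof (rule integral_mono)
      show "integrable lborel (\<lambda>x. cmod (R x))" using R_int by simp
      show "integrable lborel (\<lambda>x. (cmod h)\<^sup>2 * B x)" using B by simp
      fix x :: real
      show "cmod (R x) \<le> (cmod h)\<^sup>2 * B x"
      proof (cases "0 \<le> x")
        case True
        have "cmod (exp (of_real x * h) - 1 - of_real x * h) \<le> exp \<bar>Re (of_real x * h)\<bar> * (cmod (of_real x * h))\<^sup>2"
          using Taylor_exp[of "of_real x * h" 1] by (simp add: algebra_simps numeral_2_eq_2)
        also have "\<dots> \<le> exp (\<delta> * x) * (cmod (of_real x * h))\<^sup>2"
        proof (intro mult_right_mono)
          have "\<bar>Re (of_real x * h)\<bar> = x * \<bar>Re h\<bar>" using True by (simp add: abs_mult)
          also have "\<dots> \<le> x * \<delta>" using Re_h h True by (intro mult_left_mono) auto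
          finally show "exp \<bar>Re (of_real x * h)\<bar> \<le> exp (\<delta> * x)" by (simp add: mult.commute)
        qed simp
        also have "\<dots> = exp (\<delta> * x) * (x * x * (cmod h)\<^sup>2)"
          by (simp add: norm_mult power_mult_distrib power2_eq_square)
        finally have *: "cmod (exp (of_real x * h) - 1 - of_real x * h) \<le> exp (\<delta> * x) * (x * x * (cmod h)\<^sup>2)" .
        have "cmod (R x) = \<bar>f x\<bar> * exp (Re \<zeta> * x) * cmod (exp (of_real x * h) - 1 - of_real x * h)"
          using True by (simp add: R_def norm_mult mult.commute)
        also have "\<dots> \<le> \<bar>f x\<bar> * exp (Re \<zeta> * x) * (exp (\<delta> * x) * (x * x * (cmod h)\<^sup>2))"
          by (intro mult_left_mono *) simp
        also have "\<dots> = (cmod h)\<^sup>2 * B x"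
          using True by (simp add: B_def abs_mult distrib_right exp_add)
        finally show ?thesis .
      qed (simp add: R_def B_def)
    qed
    also have "\<dots> = cmod h * (cmod h * (LINT x|lborel. B x))" by (simp add: power2_eq_square)
    finally show ?thesis using h by simp
  qed
  have "((\<lambda>h. ?q h - ?D) \<longlongrightarrow> 0) (at 0)"
  proof (rule Lim_null_comparison)
    show "\<forall>\<^sub>F h in at 0. norm (?q h - ?D) \<le> norm h * (LINT x|lborel. B x)"
      unfolding eventually_at using \<delta> est by (auto intro!: exI[of _ \<delta>])
    show "((\<lambda>h. norm h * (LINT x|lborel. B x)) \<longlongrightarrow> 0) (at 0)"
      by (intro tendsto_mult_left_zero tendsto_norm_zero tendsto_ident_at)
  qed
  then show ?thesis
    unfolding DERIV_def by (rule LIM_zero_cancel)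
qed

lemma laplace_transform_parts:
  assumes f: "subexponential f" and f': "subexponential f'" "continuous_on UNIV f'"
    and deriv: "\<And>x. (f has_real_derivative f' x) (at x)" and s: "Re \<zeta> < 0"
  shows "\<zeta> * laplace_transform f \<zeta> = - of_real (f 0) - laplace_transform f' \<zeta>"
proof -
  have contf: "continuous_on UNIV f"
    using deriv by (meson DERIV_isCont continuous_at_imp_continuous_on)
  define P where "P = (\<lambda>x. of_real (f x) * exp (of_real x * \<zeta>) :: complex)"
  define p where "p = (\<lambda>x. of_real (f' x) * exp (of_real x * \<zeta>) + \<zeta> * (of_real (f x) * exp (of_real x * \<zeta>)))"
  have Pp: "(P has_vector_derivative p x) (at x)" for x
  proof -
    have 1: "((\<lambda>x. of_real (f x) :: complex) has_vector_derivative of_real (f' x)) (at x)"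
      using deriv[of x] by (intro has_vector_derivative_of_real) (simp add: has_real_derivative_iff_has_vector_derivative)
    have "((\<lambda>x. of_real x * \<zeta>) has_vector_derivative \<zeta>) (at x)"
      by (auto intro!: derivative_eq_intros)
    from field_vector_diff_chain_at[OF this, of exp "exp (of_real x * \<zeta>)"]
    have 2: "((\<lambda>x. exp (of_real x * \<zeta>)) has_vector_derivative \<zeta> * exp (of_real x * \<zeta>)) (at x)"
      by (simp add: o_def DERIV_exp)
    from has_vector_derivative_mult[OF 1 2] show ?thesis
      unfolding P_def p_def by (rule has_vector_derivative_eq_rhs) (simp add: algebra_simps)
  qed
  have contp: "continuous_on UNIV p" unfolding p_def by (intro continuous_intros f' contf)
  define i1 where "i1 = (\<lambda>x::real. indicator {0..} x *\<^sub>R (of_real (f' x) * exp (of_real x * \<zeta>)))"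
  define i2 where "i2 = (\<lambda>x::real. indicator {0..} x *\<^sub>R (of_real (f x) * exp (of_real x * \<zeta>)))"
  have i: "integrable lborel i1" "integrable lborel i2"
    using integrable_laplace[OF f' s] integrable_laplace[OF f contf s]
    by (simp_all add: set_integrable_def i1_def i2_def)
  have ip: "indicator {0..} x *\<^sub>R p x = i1 x + \<zeta> * i2 x" for x
    by (simp add: p_def i1_def i2_def split: split_indicator)
  have int: "integrable lborel (\<lambda>x. indicator {0..} x *\<^sub>R p x)" unfolding ip using i by simp
  have "((\<lambda>R. LINT x|lborel. indicator {..R} x *\<^sub>R (indicator {0..} x *\<^sub>R p x)) \<longlongrightarrow>
      (LINT x|lborel. indicator {0..} x *\<^sub>R p x)) at_top"
    by (rule tendsto_integral_at_top[OF _ int]) simp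
  moreover have "\<forall>\<^sub>F R in at_top. (LINT x|lborel. indicator {..R} x *\<^sub>R (indicator {0..} x *\<^sub>R p x)) = P R - P 0"
    using eventually_ge_at_top[of 0]
  proof eventually_elim
    case (elim R)
    have "indicator {..R} x *\<^sub>R (indicator {0..} x *\<^sub>R p x) = indicator {0..R} x *\<^sub>R p x" for x
      by (auto split: split_indicator)
    moreover have "(LINT x|lborel. indicator {0..R} x *\<^sub>R p x) = P R - P 0"
      by (rule integral_FTC_Icc[OF elim])
        (auto intro: has_vector_derivative_at_within Pp continuous_on_subset[OF contp])
    ultimately show ?case by (simp only:)
  qed
  ultimately have lim: "((\<lambda>R. P R - P 0) \<longlongrightarrow> (LINT x|lborel. indicator {0..} x *\<^sub>R p x)) at_top"
    by (rule Lim_transform_eventually)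
  have "(P \<longlongrightarrow> 0) at_top"
  proof -
    have "0 < - Re \<zeta> / 2" using s by simp
    then obtain C where C: "\<And>x. 0 \<le> x \<Longrightarrow> \<bar>f x\<bar> \<le> C * exp (- Re \<zeta> / 2 * x)"
      using f unfolding subexponential_def by meson
    show ?thesis
    proof (rule Lim_null_comparison)
      show "\<forall>\<^sub>F x in at_top. norm (P x) \<le> C * exp (Re \<zeta> / 2 * x)"
        using eventually_ge_at_top[of 0]
      proof eventually_elim
        case (elim x)
        have "norm (P x) = \<bar>f x\<bar> * exp (Re \<zeta> * x)" by (simp add: P_def norm_mult mult.commute)
        also have "\<dots> \<le> C * exp (- Re \<zeta> / 2 * x) * exp (Re \<zeta> * x)"
          by (intro mult_right_mono C elim) simp
        also have "\<dots> = C * exp (Re \<zeta> / 2 * x)" by (simp add: mult.assoc flip: exp_add)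
        finally show ?case .
      qed
      have "((\<lambda>x. exp (Re \<zeta> / 2 * x)) \<longlongrightarrow> 0) at_top" using s by real_asymp
      then show "((\<lambda>x. C * exp (Re \<zeta> / 2 * x)) \<longlongrightarrow> 0) at_top" by (rule tendsto_mult_right_zero)
    qed
  qed
  then have "((\<lambda>R. P R - P 0) \<longlongrightarrow> 0 - P 0) at_top" by (intro tendsto_intros)
  with lim have "(LINT x|lborel. indicator {0..} x *\<^sub>R p x) = - P 0"
    using tendsto_unique[OF trivial_limit_at_top_linorder] by fastforce
  moreover have "(LINT x|lborel. indicator {0..} x *\<^sub>R p x) = laplace_transform f' \<zeta> + \<zeta> * laplace_transform f \<zeta>"
  proof -
    have "laplace_transform f' \<zeta> = (LINT x|lborel. i1 x)" "laplace_transform f \<zeta> = (LINT x|lborel. i2 x)"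
      by (simp_all add: laplace_transform_def set_lebesgue_integral_def i1_def i2_def)
    then show ?thesis unfolding ip using i by simp
  qed
  ultimately show ?thesis by (simp add: P_def algebra_simps eq_neg_iff_add_eq_0)
qed

lemma laplace_transform_1:
  assumes "Re \<zeta> < 0"
  shows "laplace_transform (\<lambda>_. 1) \<zeta> = - 1 / \<zeta>"
proof -
  have "\<zeta> * laplace_transform (\<lambda>_. 1) \<zeta> = - of_real 1 - laplace_transform (\<lambda>_. 0) \<zeta>"
    by (rule laplace_transform_parts) (auto intro!: subexponential_const assms)
  moreover have "laplace_transform (\<lambda>_. 0) \<zeta> = 0"
    by (simp add: laplace_transform_def set_lebesgue_integral_def)
  moreover have "\<zeta> \<noteq> 0" using assms by auto
  ultimately show ?thesis by (simp add: field_simps)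
qed

text \<open>
  One integration by parts gives decay of order \<open>1 / |\<zeta>|\<close>. This is what makes the derivatives of the kernel
  square integrable on lines, without Plancherel's theorem.
\<close>

lemma laplace_transform_bound:
  assumes f: "subexponential f" and f': "subexponential f'" "continuous_on UNIV f'"
    and deriv: "\<And>x. (f has_real_derivative f' x) (at x)" and d: "0 < d"
  obtains C where "0 \<le> C" "\<And>\<zeta>. Re \<zeta> \<le> - d \<Longrightarrow> cmod (laplace_transform f \<zeta>) \<le> C / cmod \<zeta>"
proof
  define I where "I = (LINT x|lborel. indicator {0..} x * (\<bar>f' x\<bar> * exp (- d * x)))"
  have I_int: "integrable lborel (\<lambda>x. indicator {0..} x * (\<bar>f' x\<bar> * exp (- d * x)))"
    by (rule integrable_laplace_norm[OF f']) (use d in simp)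
  have "0 \<le> I" unfolding I_def by (rule Bochner_Integration.integral_nonneg) simp
  then show "0 \<le> \<bar>f 0\<bar> + I" by simp
  fix \<zeta> :: complex assume \<zeta>: "Re \<zeta> \<le> - d"
  then have s: "Re \<zeta> < 0" using d by simp
  have "cmod (laplace_transform f' \<zeta>) \<le> (LINT x|lborel. cmod (indicator {0..} x *\<^sub>R (of_real (f' x) * exp (of_real x * \<zeta>))))"
    unfolding laplace_transform_def set_lebesgue_integral_def by (rule integral_norm_bound)
  also have "\<dots> \<le> I" unfolding I_def
  proof (rule integral_mono[OF _ I_int])
    show "integrable lborel (\<lambda>x. cmod (indicator {0..} x *\<^sub>R (of_real (f' x) * exp (of_real x * \<zeta>))))"
      by (rule integrable_norm[OF integrable_laplace[OF f' s, unfolded set_integrable_def]])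
    fix x :: real
    show "cmod (indicator {0..} x *\<^sub>R (of_real (f' x) * exp (of_real x * \<zeta>))) \<le> indicator {0..} x * (\<bar>f' x\<bar> * exp (- d * x))"
    proof (cases "0 \<le> x")
      case True
      have "x * Re \<zeta> \<le> x * (- d)" using \<zeta> True by (rule mult_left_mono)
      then have "\<bar>f' x\<bar> * exp (x * Re \<zeta>) \<le> \<bar>f' x\<bar> * exp (- d * x)"
        by (intro mult_left_mono) (simp_all add: mult.commute)
      then show ?thesis using True by (simp add: norm_mult)
    qed simp
  qed
  finally have "cmod (- of_real (f 0) - laplace_transform f' \<zeta>) \<le> \<bar>f 0\<bar> + I"
    using norm_triangle_ineq4[of "- of_real (f 0)" "laplace_transform f' \<zeta>"] by simp
  then have "cmod \<zeta> * cmod (laplace_transform f \<zeta>) \<le> \<bar>f 0\<bar> + I"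
    using laplace_transform_parts[OF f f' deriv s] by (simp flip: norm_mult)
  moreover have "0 < cmod \<zeta>" using s by auto
  ultimately show "cmod (laplace_transform f \<zeta>) \<le> (\<bar>f 0\<bar> + I) / cmod \<zeta>"
    by (simp add: field_simps)
qed

section \<open>The kernel and its derivatives\<close>

definition kernel_denominator :: "nat \<Rightarrow> real \<Rightarrow> real" where
  "kernel_denominator n x = (\<Sum>k\<le>n. x ^ (2 * k))"

definition weighted_power :: "nat \<Rightarrow> nat \<Rightarrow> real \<Rightarrow> real" where
  "weighted_power n m x = x ^ m / kernel_denominator n x"

text \<open>
  The quotient rule, arranged as sums and products so that the closure rules for subexponential
  growth apply.
\<close>

definition weighted_power_deriv :: "nat \<Rightarrow> nat \<Rightarrow> real \<Rightarrow> real" where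
  "weighted_power_deriv n m x = (real m * x ^ (m - 1)) * (1 / kernel_denominator n x) +
     (- (x ^ m)) * ((\<Sum>k\<le>n. real (2 * k) * x ^ (2 * k - 1)) * (1 / kernel_denominator n x) ^ 2)"

text \<open>
  The \<open>m\<close>-th derivative of the kernel at \<open>z\<close> with respect to \<open>w\<close>: each derivative brings down a factor \<open>i x\<close>
  under the integral.
\<close>

definition kernel_deriv :: "nat \<Rightarrow> nat \<Rightarrow> complex \<Rightarrow> complex \<Rightarrow> complex" where
  "kernel_deriv n m z w =
     \<i> ^ m / (2 * of_real pi) * laplace_transform (weighted_power n m) (\<i> * (w - cnj z))"

lemma kernel_denominator_ge_1: "1 \<le> kernel_denominator n x"
proof -
  have "(\<Sum>k\<in>{0}. x ^ (2 * k)) \<le> (\<Sum>k\<le>n. x ^ (2 * k))"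
    by (intro sum_mono2) (auto simp: power_mult)
  then show ?thesis by (simp add: kernel_denominator_def)
qed

lemma kernel_denominator_nonzero: "kernel_denominator n x \<noteq> 0"
  using kernel_denominator_ge_1[of n x] by auto

lemma subexponential_inverse_denominator: "subexponential (\<lambda>x. 1 / kernel_denominator n x)"
proof (rule subexponential_bounded)
  fix x
  show "\<bar>1 / kernel_denominator n x\<bar> \<le> 1"
    using kernel_denominator_ge_1[of n x] by simp
qed

lemma continuous_kernel_denominator: "continuous_on S (kernel_denominator n)"
  unfolding kernel_denominator_def[abs_def] by (intro continuous_intros)

lemma subexponential_weighted_power: "subexponential (weighted_power n m)"
proof -
  have "weighted_power n m = (\<lambda>x. x ^ m * (1 / kernel_denominator n x))"
    by (simp add: fun_eq_iff weighted_power_def)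
  then show ?thesis
    by (simp only:) (intro subexponential_intros subexponential_inverse_denominator)
qed

lemma continuous_weighted_power: "continuous_on S (weighted_power n m)"
  unfolding weighted_power_def[abs_def]
  by (intro continuous_intros continuous_kernel_denominator) (simp add: kernel_denominator_nonzero)

lemma subexponential_weighted_power_deriv: "subexponential (weighted_power_deriv n m)"
proof -
  have "subexponential (\<lambda>x. (- 1) * x ^ m)" by (intro subexponential_intros)
  then have "subexponential (\<lambda>x. - (x ^ m))" by simp
  then show ?thesis
    unfolding weighted_power_deriv_def[abs_def]
    by (intro subexponential_intros subexponential_inverse_denominator)
qed

lemma continuous_weighted_power_deriv: "continuous_on S (weighted_power_deriv n m)"
  unfolding weighted_power_deriv_def[abs_def]
  by (intro continuous_intros continuous_kernel_denominator) (simp_all add: kernel_denominator_nonzero)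

lemma weighted_power_has_derivative:
  "(weighted_power n m has_real_derivative weighted_power_deriv n m x) (at x)"
proof -
  have "(kernel_denominator n has_real_derivative (\<Sum>k\<le>n. real (2 * k) * x ^ (2 * k - 1))) (at x)"
    unfolding kernel_denominator_def[abs_def]
    by (intro DERIV_sum) (auto intro!: derivative_eq_intros)
  from DERIV_divide[OF DERIV_power[OF DERIV_ident] this kernel_denominator_nonzero, of m]
  show ?thesis
    unfolding weighted_power_def[abs_def] weighted_power_deriv_def
    using kernel_denominator_nonzero[of n x]
    by (simp add: field_simps power2_eq_square)
qed

lemma hardy_sobolev_kernel_eq: "hardy_sobolev_kernel n z = kernel_deriv n 0 z"
proof
  fix w
  have "(LINT x:{0..}|lborel. of_real (kernel_weight n x) * exp (\<i> * of_real x * (w - cnj z))) =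
      (LINT x:{0..}|lborel. of_real (weighted_power n 0 x) * exp (of_real x * (\<i> * (w - cnj z))))"
    by (rule set_lebesgue_integral_cong)
      (auto simp: kernel_weight_eq weighted_power_def kernel_denominator_def mult_ac)
  then show "hardy_sobolev_kernel n z w = kernel_deriv n 0 z w"
    by (simp add: hardy_sobolev_kernel_def kernel_deriv_def laplace_transform_def)
qed

lemma kernel_deriv_has_derivative:
  assumes w: "- Im z < Im w"
  shows "(kernel_deriv n m z has_field_derivative kernel_deriv n (Suc m) z w) (at w)"
proof -
  have "Re (\<i> * (w - cnj z)) < 0" using w by simp
  note D = laplace_transform_deriv[OF subexponential_weighted_power continuous_weighted_power this, of n m]
  have eq: "(\<lambda>x. x * weighted_power n m x) = weighted_power n (Suc m)"
    by (simp add: fun_eq_iff weighted_power_def)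
  have "((\<lambda>w. \<i> * (w - cnj z)) has_field_derivative \<i>) (at w)"
    by (auto intro!: derivative_eq_intros)
  with D have "((\<lambda>w. laplace_transform (weighted_power n m) (\<i> * (w - cnj z))) has_field_derivative
      laplace_transform (weighted_power n (Suc m)) (\<i> * (w - cnj z)) * \<i>) (at w)"
    unfolding eq by (rule DERIV_chain2)
  from DERIV_cmult[OF this, of "\<i> ^ m / (2 * of_real pi)"]
  show ?thesis
    unfolding kernel_deriv_def[abs_def] by (simp add: mult_ac)
qed

lemma kernel_deriv_holomorphic: "kernel_deriv n m z holomorphic_on {w. - Im z < Im w}"
proof (rule holomorphic_onI)
  fix w assume "w \<in> {w. - Im z < Im w}"
  then have "(kernel_deriv n m z has_field_derivative kernel_deriv n (Suc m) z w) (at w)"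
    using kernel_deriv_has_derivative[of z w n m] by simp
  then show "kernel_deriv n m z field_differentiable at w within {w. - Im z < Im w}"
    unfolding field_differentiable_def using has_field_derivative_at_within by blast
qed

lemma kernel_funpow_deriv:
  assumes "- Im z < Im w"
  shows "(deriv ^^ k) (hardy_sobolev_kernel n z) w = kernel_deriv n k z w"
  using assms
proof (induction k arbitrary: w)
  case 0
  then show ?case by (simp add: hardy_sobolev_kernel_eq)
next
  case (Suc k)
  have "((deriv ^^ k) (hardy_sobolev_kernel n z) has_field_derivative kernel_deriv n (Suc k) z w) (at w)"
    by (rule has_field_derivative_transform_within_open[OF kernel_deriv_has_derivative[OF Suc.prems] open_halfspace_Im_gt])
      (use Suc in auto)
  then show ?case by (simp add: DERIV_imp_deriv)
qed

lemma kernel_deriv_bound: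
  assumes z: "0 < Im z"
  obtains C where "0 \<le> C" "\<And>w. 0 \<le> Im w \<Longrightarrow> cmod (kernel_deriv n m z w) \<le> C / cmod (w - cnj z)"
proof -
  obtain C where C: "0 \<le> C" "\<And>\<zeta>. Re \<zeta> \<le> - Im z \<Longrightarrow> cmod (laplace_transform (weighted_power n m) \<zeta>) \<le> C / cmod \<zeta>"
    using laplace_transform_bound[OF subexponential_weighted_power subexponential_weighted_power_deriv
        continuous_weighted_power_deriv weighted_power_has_derivative z] by metis
  show ?thesis
  proof (rule that[of "C / (2 * pi)"])
    show "0 \<le> C / (2 * pi)" using C by simp
    fix w :: complex assume "0 \<le> Im w"
    then have "cmod (laplace_transform (weighted_power n m) (\<i> * (w - cnj z))) \<le> C / cmod (w - cnj z)"
      using C(2)[of "\<i> * (w - cnj z)"] by (simp add: norm_mult)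
    then have "1 / (2 * pi) * cmod (laplace_transform (weighted_power n m) (\<i> * (w - cnj z))) \<le> 1 / (2 * pi) * (C / cmod (w - cnj z))"
      by (intro mult_left_mono) simp_all
    then show "cmod (kernel_deriv n m z w) \<le> C / (2 * pi) / cmod (w - cnj z)"
      by (simp add: kernel_deriv_def norm_mult norm_divide norm_power)
  qed
qed

lemma kernel_deriv_line_sq:
  assumes z: "0 < Im z"
  obtains C where "0 \<le> C"
    "\<And>y. 0 \<le> y \<Longrightarrow> (\<integral>\<^sup>+x. ennreal ((cmod (kernel_deriv n m z (Complex x y)))\<^sup>2) \<partial>lborel) \<le> ennreal C"
proof -
  obtain C where C: "0 \<le> C" "\<And>w. 0 \<le> Im w \<Longrightarrow> cmod (kernel_deriv n m z w) \<le> C / cmod (w - cnj z)"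
    using kernel_deriv_bound[OF z] by metis
  show ?thesis
  proof (rule that[of "C\<^sup>2 * (pi / Im z)"])
    show "0 \<le> C\<^sup>2 * (pi / Im z)" using z by simp
    fix y :: real assume y: "0 \<le> y"
    have "(\<integral>\<^sup>+x. ennreal ((cmod (kernel_deriv n m z (Complex x y)))\<^sup>2) \<partial>lborel) \<le>
        (\<integral>\<^sup>+x. ennreal (C\<^sup>2) * ennreal (1 / ((x - Re z)\<^sup>2 + (Im z)\<^sup>2)) \<partial>lborel)"
    proof (rule nn_integral_mono)
      fix x
      have "(cmod (kernel_deriv n m z (Complex x y)))\<^sup>2 \<le> (C / cmod (Complex x y - cnj z))\<^sup>2"
        using C(2)[of "Complex x y"] y by (intro power_mono) auto
      also have "\<dots> = C\<^sup>2 / ((x - Re z)\<^sup>2 + (y + Im z)\<^sup>2)"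
        by (simp add: power_divide cmod_power2)
      also have "\<dots> \<le> C\<^sup>2 / ((x - Re z)\<^sup>2 + (Im z)\<^sup>2)"
        using z y by (intro divide_left_mono add_left_mono power_mono)
          (auto intro!: mult_pos_pos add_nonneg_pos)
      finally show "ennreal ((cmod (kernel_deriv n m z (Complex x y)))\<^sup>2) \<le>
          ennreal (C\<^sup>2) * ennreal (1 / ((x - Re z)\<^sup>2 + (Im z)\<^sup>2))"
        by (simp add: ennreal_leI flip: ennreal_mult)
    qed
    also have "\<dots> = ennreal (C\<^sup>2) * ennreal (pi / Im z)"
      by (subst nn_integral_cmult) (simp_all add: poisson_kernel_nn_integral[OF z])
    also have "\<dots> = ennreal (C\<^sup>2 * (pi / Im z))" using z by (simp flip: ennreal_mult)
    finally show "(\<integral>\<^sup>+x. ennreal ((cmod (kernel_deriv n m z (Complex x y)))\<^sup>2) \<partial>lborel) \<le> ennreal (C\<^sup>2 * (pi / Im z))" .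
  qed
qed

lemma kernel_in_hardy_sobolev_space:
  assumes z: "z \<in> upper_half_plane"
  shows "hardy_sobolev_kernel n z \<in> hardy_sobolev_space n"
proof -
  have z: "0 < Im z" using z by (simp add: upper_half_plane_def)
  have holo: "(deriv ^^ k) (hardy_sobolev_kernel n z) holomorphic_on upper_half_plane" for k
  proof (rule holomorphic_transform)
    show "kernel_deriv n k z holomorphic_on upper_half_plane"
      by (rule holomorphic_on_subset[OF kernel_deriv_holomorphic]) (use z in \<open>auto simp: upper_half_plane_def\<close>)
  qed (use z in \<open>auto simp: upper_half_plane_def kernel_funpow_deriv\<close>)
  have "(deriv ^^ k) (hardy_sobolev_kernel n z) \<in> hardy_space" for k
  proof -
    obtain C where C: "0 \<le> C" "\<And>y. 0 \<le> y \<Longrightarrow> (\<integral>\<^sup>+x. ennreal ((cmod (kernel_deriv n k z (Complex x y)))\<^sup>2) \<partial>lborel) \<le> ennreal C"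
      using kernel_deriv_line_sq[OF z] by metis
    show ?thesis
      by (rule hardy_spaceI(1)[OF holo C(1)]) (use z C(2) in \<open>simp add: kernel_funpow_deriv\<close>)
  qed
  with holo[of 0] show ?thesis by (simp add: hardy_sobolev_space_def)
qed

text \<open>
  The kernel is holomorphic across the real line, down to height \<open>- Im z\<close>, so its boundary values are
  ordinary values.
\<close>

lemma boundary_value_kernel_funpow_deriv:
  assumes z: "0 < Im z"
  shows "boundary_value ((deriv ^^ k) (hardy_sobolev_kernel n z)) x = kernel_deriv n k z (of_real x)"
proof (rule boundary_value_eqI)
  have "((deriv ^^ k) (hardy_sobolev_kernel n z) \<longlongrightarrow> kernel_deriv n k z (of_real x)) (at (of_real x))"
  proof (rule Lim_transform_within_open)
    show "(kernel_deriv n k z \<longlongrightarrow> kernel_deriv n k z (of_real x)) (at (of_real x))"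
      using DERIV_isCont[OF kernel_deriv_has_derivative[of z "of_real x"]] z by (simp add: isCont_def)
    show "open {w. - Im z < Im w}" by (rule open_halfspace_Im_gt)
  qed (use z in \<open>auto simp: kernel_funpow_deriv\<close>)
  then show "has_nontangential_limit ((deriv ^^ k) (hardy_sobolev_kernel n z)) x (kernel_deriv n k z (of_real x))"
    unfolding has_nontangential_limit_def by (auto intro: tendsto_within_subset)
qed

text \<open>
  The signs cancel against \<open>i\<^bsup>2k\<^esup>\<close>, and the weights \<open>x\<^bsup>2k\<^esup>\<close> add up to the denominator of the kernel. What
  remains is the transform of the constant 1, the Szego kernel.
\<close>

lemma kernel_deriv_alternating_sum:
  assumes z: "0 < Im z"
  shows "(\<Sum>k\<le>n. (- 1) ^ k * kernel_deriv n (2 * k) z (of_real x)) =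
    \<i> / (2 * of_real pi * (of_real x - cnj z))"
proof -
  define \<zeta> where "\<zeta> = \<i> * (of_real x - cnj z)"
  have \<zeta>: "Re \<zeta> < 0" using z by (simp add: \<zeta>_def)
  have "(\<Sum>k\<le>n. (- 1) ^ k * kernel_deriv n (2 * k) z (of_real x)) =
      (\<Sum>k\<le>n. 1 / (2 * of_real pi) * laplace_transform (weighted_power n (2 * k)) \<zeta>)"
  proof (rule sum.cong[OF refl])
    fix k
    have "(- 1) ^ k * \<i> ^ (2 * k) = (1::complex)"
      by (simp add: power_mult flip: power_mult_distrib)
    then have "(- 1) ^ k * (\<i> ^ (2 * k) / (2 * of_real pi) * L) = 1 / (2 * of_real pi) * L" for L :: complex
      by (metis (no_types) mult.assoc times_divide_eq_right)
    then show "(- 1) ^ k * kernel_deriv n (2 * k) z (of_real x) =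
        1 / (2 * of_real pi) * laplace_transform (weighted_power n (2 * k)) \<zeta>"
      by (simp only: kernel_deriv_def \<zeta>_def)
  qed
  also have "\<dots> = 1 / (2 * of_real pi) * laplace_transform (\<lambda>x. \<Sum>k\<le>n. weighted_power n (2 * k) x) \<zeta>"
    by (subst laplace_transform_sum)
      (simp_all add: subexponential_weighted_power continuous_weighted_power \<zeta> sum_distrib_left)
  also have "(\<lambda>x. \<Sum>k\<le>n. weighted_power n (2 * k) x) = (\<lambda>_. 1)"
    using kernel_denominator_nonzero[of n]
    by (simp add: fun_eq_iff weighted_power_def kernel_denominator_def flip: sum_divide_distrib)
  also have "laplace_transform (\<lambda>_. 1) \<zeta> = - 1 / \<zeta>" by (rule laplace_transform_1[OF \<zeta>])
  also have "1 / (2 * of_real pi) * (- 1 / \<zeta>) = \<i> / (2 * of_real pi * (of_real x - cnj z))"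
  proof -
    have "- 1 / \<zeta> = \<i> / (of_real x - cnj z)"
      unfolding \<zeta>_def by (simp add: divide_simps)
    then show ?thesis by (simp only: times_divide_times_eq mult_1)
  qed
  finally show ?thesis .
qed

section \<open>The reproducing property\<close>

lemma kernel_deriv_real_line_continuous:
  assumes z: "0 < Im z"
  shows "continuous_on UNIV (\<lambda>x::real. kernel_deriv n m z (of_real x))"
  by (rule continuous_on_compose2[OF holomorphic_on_imp_continuous_on[OF kernel_deriv_holomorphic]])
    (use z in \<open>auto intro!: continuous_intros\<close>)

lemma kernel_deriv_real_line_measurable:
  assumes z: "0 < Im z"
  shows "(\<lambda>x::real. kernel_deriv n m z (of_real x)) \<in> borel_measurable borel"
  by (rule borel_measurable_continuous_onI[OF kernel_deriv_real_line_continuous[OF z]])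

lemma kernel_deriv_real_line_integrable:
  assumes z: "0 < Im z"
  shows "integrable lborel (\<lambda>x::real. (cmod (kernel_deriv n m z (of_real x)))\<^sup>2)"
proof -
  obtain C where "\<And>y. 0 \<le> y \<Longrightarrow> (\<integral>\<^sup>+x. ennreal ((cmod (kernel_deriv n m z (Complex x y)))\<^sup>2) \<partial>lborel) \<le> ennreal C"
    using kernel_deriv_line_sq[OF z] by metis
  from this[of 0] have le: "(\<integral>\<^sup>+x. ennreal ((cmod (kernel_deriv n m z (of_real x)))\<^sup>2) \<partial>lborel) \<le> ennreal C"
    by (simp add: complex_of_real_def)
  show ?thesis
    using kernel_deriv_real_line_measurable[OF z] le_less_trans[OF le]
    by (simp add: integrable_iff_bounded)
qed

lemma integrable_line_mult_kernel_deriv: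
  assumes G: "G \<in> hardy_space" and e: "0 < e" and z: "0 < Im z"
  shows "integrable lborel (\<lambda>x. G (Complex x e) * cnj (kernel_deriv n m z (of_real x)))"
  using hardy_line_measurable[OF G e] hardy_line_integrable[OF G e]
    kernel_deriv_real_line_measurable[OF z] kernel_deriv_real_line_integrable[OF z]
  by (intro integrable_mult_cnj) auto

text \<open>
  The product of \<open>F\<close> and the conjugate kernel is integrable on the line, as is its derivative, since all four
  factors are square integrable; so the integral of the derivative is zero.
\<close>

lemma line_inner_product_by_parts:
  assumes F: "F \<in> hardy_space" "deriv F \<in> hardy_space" and e: "0 < e" and z: "0 < Im z"
  shows "(LINT x|lborel. deriv F (Complex x e) * cnj (kernel_deriv n m z (of_real x))) =
    - (LINT x|lborel. F (Complex x e) * cnj (kernel_deriv n (Suc m) z (of_real x)))"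
proof -
  note int = integrable_line_mult_kernel_deriv[OF _ e z]
  have D: "((\<lambda>x. F (Complex x e) * cnj (kernel_deriv n m z (of_real x))) has_vector_derivative
      deriv F (Complex x e) * cnj (kernel_deriv n m z (of_real x)) +
      F (Complex x e) * cnj (kernel_deriv n (Suc m) z (of_real x))) (at x)" for x
  proof -
    have "(F has_field_derivative deriv F (Complex x e)) (at (Complex x e))"
      using holomorphic_derivI[OF hardy_holomorphic[OF F(1)] open_upper_half_plane] e by simp
    then have 1: "((\<lambda>x. F (Complex x e)) has_vector_derivative deriv F (Complex x e)) (at x)"
      by (rule has_vector_derivative_Complex_Re)
    have "(kernel_deriv n m z has_field_derivative kernel_deriv n (Suc m) z (of_real x)) (at (Complex x 0))"
      using kernel_deriv_has_derivative[of z "of_real x" n m] z by (simp add: complex_of_real_def)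
    from has_vector_derivative_Complex_Re[OF this]
    have "((\<lambda>x. kernel_deriv n m z (of_real x)) has_vector_derivative kernel_deriv n (Suc m) z (of_real x)) (at x)"
      by (simp add: complex_of_real_def)
    then have 2: "((\<lambda>x. cnj (kernel_deriv n m z (of_real x))) has_vector_derivative cnj (kernel_deriv n (Suc m) z (of_real x))) (at x)"
      by (rule has_vector_derivative_cnj)
    from has_vector_derivative_mult[OF 1 2] show ?thesis by (simp add: add.commute)
  qed
  have cont: "continuous_on UNIV (\<lambda>x. deriv F (Complex x e) * cnj (kernel_deriv n m z (of_real x)) +
      F (Complex x e) * cnj (kernel_deriv n (Suc m) z (of_real x)))"
    using e by (intro continuous_intros kernel_deriv_real_line_continuous[OF z] continuous_on_line[OF hardy_continuous] F) auto
  have "(LINT x|lborel. deriv F (Complex x e) * cnj (kernel_deriv n m z (of_real x)) +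
      F (Complex x e) * cnj (kernel_deriv n (Suc m) z (of_real x))) = 0"
    by (rule integral_derivative_eq_0[OF D cont]) (intro int F Bochner_Integration.integrable_add)+
  then show ?thesis using int F by (simp add: eq_neg_iff_add_eq_0)
qed

lemma line_inner_product_iterated_parts:
  assumes F: "\<And>j. j \<le> k \<Longrightarrow> (deriv ^^ j) F \<in> hardy_space" and e: "0 < e" and z: "0 < Im z"
  shows "(LINT x|lborel. (deriv ^^ k) F (Complex x e) * cnj (kernel_deriv n m z (of_real x))) =
    (- 1) ^ k * (LINT x|lborel. F (Complex x e) * cnj (kernel_deriv n (m + k) z (of_real x)))"
  using F
proof (induction k arbitrary: m)
  case (Suc k)
  have hardy: "(deriv ^^ k) F \<in> hardy_space" "deriv ((deriv ^^ k) F) \<in> hardy_space"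
    using Suc.prems[of k] Suc.prems[of "Suc k"] by simp_all
  have "(LINT x|lborel. (deriv ^^ Suc k) F (Complex x e) * cnj (kernel_deriv n m z (of_real x))) =
      - (LINT x|lborel. (deriv ^^ k) F (Complex x e) * cnj (kernel_deriv n (Suc m) z (of_real x)))"
    using line_inner_product_by_parts[OF hardy e z] by simp
  also have "\<dots> = - ((- 1) ^ k * (LINT x|lborel. F (Complex x e) * cnj (kernel_deriv n (Suc m + k) z (of_real x))))"
    using Suc by simp
  finally show ?case by simp
qed simp

text \<open>
  After integration by parts the kernel derivatives combine to the Szego kernel. On the real line
  \<open>x - z\<close> is \<open>(x + i e) - (z + i e)\<close>, so Cauchy's formula evaluates \<open>F\<close> at the raised point \<open>z + i e\<close>.
\<close>

lemma line_sobolev_inner_product_kernel: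
  assumes F: "\<And>k. k \<le> n \<Longrightarrow> (deriv ^^ k) F \<in> hardy_space" and e: "0 < e" and z: "0 < Im z"
  shows "(\<Sum>k\<le>n. LINT x|lborel. (deriv ^^ k) F (Complex x e) * cnj (kernel_deriv n k z (of_real x))) =
    F (z + \<i> * of_real e)"
proof -
  have F0: "F \<in> hardy_space" using F[of 0] by simp
  note int = integrable_line_mult_kernel_deriv[OF F0 e z]
  have "(\<Sum>k\<le>n. LINT x|lborel. (deriv ^^ k) F (Complex x e) * cnj (kernel_deriv n k z (of_real x))) =
      (\<Sum>k\<le>n. LINT x|lborel. (- 1) ^ k * (F (Complex x e) * cnj (kernel_deriv n (2 * k) z (of_real x))))"
  proof (rule sum.cong[OF refl])
    fix k assume "k \<in> {..n}"
    then have "\<And>j. j \<le> k \<Longrightarrow> (deriv ^^ j) F \<in> hardy_space" using F by auto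
    from line_inner_product_iterated_parts[OF this e z, of k n k]
    show "(LINT x|lborel. (deriv ^^ k) F (Complex x e) * cnj (kernel_deriv n k z (of_real x))) =
        (LINT x|lborel. (- 1) ^ k * (F (Complex x e) * cnj (kernel_deriv n (2 * k) z (of_real x))))"
      by (simp add: mult_2)
  qed
  also have "\<dots> = (LINT x|lborel. (\<Sum>k\<le>n. (- 1) ^ k * (F (Complex x e) * cnj (kernel_deriv n (2 * k) z (of_real x)))))"
    by (rule Bochner_Integration.integral_sum[symmetric]) (intro integrable_mult_right int)
  also have "\<dots> = (LINT x|lborel. 1 / (2 * of_real pi * \<i>) * (F (Complex x e) / (Complex x e - (z + \<i> * of_real e))))"
  proof (rule Bochner_Integration.integral_cong[OF refl])
    fix x :: real
    have "(\<Sum>k\<le>n. (- 1) ^ k * (F (Complex x e) * cnj (kernel_deriv n (2 * k) z (of_real x)))) =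
        F (Complex x e) * cnj (\<Sum>k\<le>n. (- 1) ^ k * kernel_deriv n (2 * k) z (of_real x))"
      by (simp add: sum_distrib_left mult.left_commute)
    also have "\<dots> = F (Complex x e) * (- \<i> / (2 * of_real pi * (of_real x - z)))"
      unfolding kernel_deriv_alternating_sum[OF z] by simp
    also have "of_real x - z = Complex x e - (z + \<i> * of_real e)"
      by (simp add: complex_eq_iff)
    also have "F (Complex x e) * (- \<i> / (2 * of_real pi * (Complex x e - (z + \<i> * of_real e)))) =
        1 / (2 * of_real pi * \<i>) * (F (Complex x e) / (Complex x e - (z + \<i> * of_real e)))"
    proof -
      have "- \<i> = 1 / \<i>" by simp
      then show ?thesis by (simp only: times_divide_times_eq divide_divide_eq_left times_divide_eq_right mult_1 mult_1_right ac_simps)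
    qed
    finally show "(\<Sum>k\<le>n. (- 1) ^ k * (F (Complex x e) * cnj (kernel_deriv n (2 * k) z (of_real x)))) =
        1 / (2 * of_real pi * \<i>) * (F (Complex x e) / (Complex x e - (z + \<i> * of_real e)))" .
  qed
  also have "\<dots> = 1 / (2 * of_real pi * \<i>) * (2 * of_real pi * \<i> * F (z + \<i> * of_real e))"
  proof -
    have "(LINT x|lborel. F (Complex x e) / (Complex x e - (z + \<i> * of_real e))) =
        2 * of_real pi * \<i> * F (z + \<i> * of_real e)"
      by (rule line_cauchy_integral_above(2)[OF F0 e]) (use z in simp)
    then show ?thesis by (simp only: integral_mult_right_zero)
  qed
  finally show ?thesis by simp
qed

theorem theorem4p3:
  fixes n :: nat
  shows "is_reproducing_kernel upper_half_plane (hardy_sobolev_space n) (hardy_sobolev_inner n)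
           (hardy_sobolev_kernel n)"
  unfolding is_reproducing_kernel_def
proof (intro ballI conjI)
  fix z assume zU: "z \<in> upper_half_plane"
  then show "hardy_sobolev_kernel n z \<in> hardy_sobolev_space n" by (rule kernel_in_hardy_sobolev_space)
  have z: "0 < Im z" using zU by (simp add: upper_half_plane_def)
  fix F assume "F \<in> hardy_sobolev_space n"
  then have F: "\<And>k. k \<le> n \<Longrightarrow> (deriv ^^ k) F \<in> hardy_space" by (simp add: hardy_sobolev_space_def)
  have F0: "F \<in> hardy_space" using F[of 0] by simp
  have "((\<lambda>e. \<Sum>k\<le>n. LINT x|lborel. (deriv ^^ k) F (Complex x e) * cnj (kernel_deriv n k z (of_real x)))
      \<longlongrightarrow> hardy_sobolev_inner n F (hardy_sobolev_kernel n z)) (at_right 0)"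
    unfolding hardy_sobolev_inner_def hardy_inner_def boundary_value_kernel_funpow_deriv[OF z]
    by (intro tendsto_sum boundary_inner_product_limit F kernel_deriv_real_line_measurable
        kernel_deriv_real_line_integrable z) simp
  then have 1: "((\<lambda>e. F (z + \<i> * of_real e)) \<longlongrightarrow> hardy_sobolev_inner n F (hardy_sobolev_kernel n z)) (at_right 0)"
    by (rule Lim_transform_eventually)
      (use line_sobolev_inner_product_kernel[OF F _ z] in
        \<open>intro eventually_mono[OF eventually_at_right_less[of "0::real"]], blast\<close>)
  have "((\<lambda>e. z + \<i> * of_real e) \<longlongrightarrow> z + \<i> * of_real 0) (at_right 0)"
    by (intro tendsto_intros)
  then have 2: "((\<lambda>e. F (z + \<i> * of_real e)) \<longlongrightarrow> F z) (at_right 0)"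
    by (intro isCont_tendsto_compose[OF hardy_isCont[OF F0 z]]) simp
  show "F z = hardy_sobolev_inner n F (hardy_sobolev_kernel n z)"
    by (rule tendsto_unique[OF trivial_limit_at_right_real 2 1])
qed

end
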